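(* Let $\boldsymbol\theta_0\in\Theta_1$, let $\mathbb Q_0=\mathbb Q_{0,\beta,\mathbf A_n}$ be an Ising model and $\mathbf X^n\sim P_{\boldsymbol\theta_0,\mathbb Q_0}$, and assume $$\sup_{\boldsymbol\theta\in\Theta}\Big\|\mathbb E^{\mathbb Q_{\boldsymbol\theta}}\Big[\sum_{i=1}^n\mathbf X_iW_i\Big]-\sum_{i=1}^n\mathbf X_i\tanh(\boldsymbol\theta^\top\mathbf X_i)\Big\|=o_p(\sqrt n).\qquad(\ast)$$ For $\mathbf h\in\mathbb R^d$ let $\boldsymbol\theta_n=\boldsymbol\theta_0+\mathbf h/\sqrt n$. Then $$\log\frac{dP_{\boldsymbol\theta_n,\mathbb Q_0}}{dP_{\boldsymbol\theta_0,\mathbb Q_0}}(\mathbf X^n)=\mathbf h^\top\Delta_{n,\boldsymbol\theta_0}(\mathbf X^n)-\tfrac12\mathbf h^\top I_0(\boldsymbol\theta_0)\mathbf h+o_p(1),$$ where $\Delta_{n,\boldsymbol\theta_0}(\mathbf X^n)=\sqrt n\big(\frac1n\sum_i\mathbf X_i\tanh(\boldsymbol\theta_0^\top\mathbf X_i)-\boldsymbol\theta_0\big)\xrightarrow{d}N_d(0,I_0(\boldsymbol\theta_0))$ under $P_{\boldsymbol\theta_0,\mathbb Q_0}$. Hence $\{P_{\boldsymbol\theta,\mathbb Q_0}\}_{\boldsymbol\theta\in\Theta_1}$ is locally asymptotically normal at every $\boldsymbol\theta_0\in\Theta_1$ with precision matrix $I_0(\boldsymbol\theta_0)$.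
   Context: Model: $\mathbf Z^n\sim\mathbb Q_0$ on $\{-1,1\}^n$; conditionally on $\mathbf Z^n$ the $\mathbf X_i$ are independent $N_d(\boldsymbol\theta Z_i,\mathbf I_d)$; $P_{\boldsymbol\theta,\mathbb Q_0}$ is the law of $\mathbf X^n$. $\Theta=\mathbb R^d\setminus\{\mathbf 0\}$, $\Theta_1$ the lexicographically positive half-space. Ising model $\mathbb Q_{0,\beta,\mathbf A_n}(\mathbf z)\propto e^{\frac\beta2\mathbf z^\top\mathbf A_n\mathbf z}$ with $\mathbf A_n$ symmetric, nonnegative, zero diagonal, $\beta\ge 0$. $\mathbb Q_{\boldsymbol\theta}(\mathbf w)\propto\exp(\frac\beta2\mathbf w^\top\mathbf A_n\mathbf w+\boldsymbol\theta^\top\sum_i\mathbf X_iw_i)$ on $\{-1,1\}^n$ (given $\mathbf X^n$), and $\mathbb E^{\mathbb Q_{\boldsymbol\theta}}$ is expectation in $\mathbf W^n\sim\mathbb Q_{\boldsymbol\theta}$. $I_0(\boldsymbol\theta_0)=\mathbf I_d-\mathbb E_{\mathbf X\sim N_d(\boldsymbol\theta_0,\mathbf I_d)}\mathbf X\mathbf X^\top\operatorname{sech}^2(\boldsymbol\theta_0^\top\mathbf X)$. *)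

theory Defs
  imports "HOL-Probability.Probability"
begin

text \<open>Dimension d is the cardinality of the finite, linearly ordered index type 'd.
  A sample X^n is a function nat => real^'d, only indices 0..<n matter.\<close>

definition gauss_dens :: "real^'d \<Rightarrow> real" where
  "gauss_dens v = (2 * pi) powr (- real CARD('d) / 2) * exp (- (norm v)\<^sup>2 / 2)"

definition spins :: "nat \<Rightarrow> (nat \<Rightarrow> real) set" where
  "spins n = PiE {..<n} (\<lambda>_. {-1, 1})"

definition ising_energy :: "real \<Rightarrow> (nat \<Rightarrow> nat \<Rightarrow> nat \<Rightarrow> real) \<Rightarrow> nat \<Rightarrow> (nat \<Rightarrow> real) \<Rightarrow> real" where
  "ising_energy \<beta> A n z = \<beta> / 2 * (\<Sum>i<n. \<Sum>j<n. z i * A n i j * z j)"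

definition ising_pmf :: "real \<Rightarrow> (nat \<Rightarrow> nat \<Rightarrow> nat \<Rightarrow> real) \<Rightarrow> nat \<Rightarrow> (nat \<Rightarrow> real) \<Rightarrow> real" where
  "ising_pmf \<beta> A n z =
     exp (ising_energy \<beta> A n z) / (\<Sum>z'\<in>spins n. exp (ising_energy \<beta> A n z'))"

definition lik :: "real \<Rightarrow> (nat \<Rightarrow> nat \<Rightarrow> nat \<Rightarrow> real) \<Rightarrow> nat \<Rightarrow> real^'d \<Rightarrow> (nat \<Rightarrow> real^'d) \<Rightarrow> real" where
  "lik \<beta> A n \<theta> x =
     (\<Sum>z\<in>spins n. ising_pmf \<beta> A n z * (\<Prod>i<n. gauss_dens (x i - z i *\<^sub>R \<theta>)))"

definition sample_space :: "nat \<Rightarrow> (nat \<Rightarrow> real^'d) measure" where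
  "sample_space n = PiM {..<n} (\<lambda>_. lborel)"

definition model :: "real \<Rightarrow> (nat \<Rightarrow> nat \<Rightarrow> nat \<Rightarrow> real) \<Rightarrow> real^'d \<Rightarrow> nat \<Rightarrow> (nat \<Rightarrow> real^'d) measure" where
  "model \<beta> A \<theta> n = density (sample_space n) (\<lambda>x. ennreal (lik \<beta> A n \<theta> x))"

definition post_energy :: "real \<Rightarrow> (nat \<Rightarrow> nat \<Rightarrow> nat \<Rightarrow> real) \<Rightarrow> nat \<Rightarrow> real^'d \<Rightarrow> (nat \<Rightarrow> real^'d) \<Rightarrow> (nat \<Rightarrow> real) \<Rightarrow> real" where
  "post_energy \<beta> A n \<theta> x w = ising_energy \<beta> A n w + \<theta> \<bullet> (\<Sum>i<n. w i *\<^sub>R x i)"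

definition post_mean :: "real \<Rightarrow> (nat \<Rightarrow> nat \<Rightarrow> nat \<Rightarrow> real) \<Rightarrow> nat \<Rightarrow> real^'d \<Rightarrow> (nat \<Rightarrow> real^'d) \<Rightarrow> real^'d" where
  "post_mean \<beta> A n \<theta> x =
     (\<Sum>w\<in>spins n. (exp (post_energy \<beta> A n \<theta> x w)
                      / (\<Sum>w'\<in>spins n. exp (post_energy \<beta> A n \<theta> x w')))
                   *\<^sub>R (\<Sum>i<n. w i *\<^sub>R x i))"

definition lex_pos :: "real^'d::{finite,linorder} \<Rightarrow> bool" where
  "lex_pos \<theta> \<longleftrightarrow> (\<exists>k. 0 < \<theta> $ k \<and> (\<forall>j<k. \<theta> $ j = 0))"

definition sech :: "real \<Rightarrow> real" where
  "sech t = 1 / cosh t"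

definition info0 :: "real^'d \<Rightarrow> real^'d^'d" where
  "info0 \<theta>0 = mat 1 - (\<chi> i j. LINT x|lborel. gauss_dens (x - \<theta>0) * (x $ i * x $ j) * (sech (\<theta>0 \<bullet> x))\<^sup>2)"

definition score_stat :: "real^'d \<Rightarrow> nat \<Rightarrow> (nat \<Rightarrow> real^'d) \<Rightarrow> real^'d" where
  "score_stat \<theta>0 n x =
     sqrt (real n) *\<^sub>R ((1 / real n) *\<^sub>R (\<Sum>i<n. tanh (\<theta>0 \<bullet> x i) *\<^sub>R x i) - \<theta>0)"

definition o_prob :: "(nat \<Rightarrow> 'a measure) \<Rightarrow> (nat \<Rightarrow> 'a \<Rightarrow> real) \<Rightarrow> (nat \<Rightarrow> real) \<Rightarrow> bool" where
  "o_prob P Y r \<longleftrightarrow> (\<forall>n. Y n \<in> borel_measurable (P n)) \<and>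
     (\<forall>\<epsilon>>0. (\<lambda>n. measure (P n) {x \<in> space (P n). \<bar>Y n x\<bar> > \<epsilon> * r n}) \<longlonglongrightarrow> 0)"

definition std_mvnormal :: "(real^'d) measure" where
  "std_mvnormal = density lborel (\<lambda>z. ennreal (gauss_dens z))"

definition mvnormal :: "real^'d^'d \<Rightarrow> (real^'d) measure" where
  "mvnormal \<Sigma> = distr std_mvnormal borel
     (\<lambda>z. (SOME B :: real^'d^'d. B ** transpose B = \<Sigma>) *v z)"

definition weak_conv_vec :: "(nat \<Rightarrow> (real^'d) measure) \<Rightarrow> (real^'d) measure \<Rightarrow> bool" where
  "weak_conv_vec M L \<longleftrightarrow>
     (\<forall>f :: real^'d \<Rightarrow> real. continuous_on UNIV f \<and> bounded (range f) \<longrightarrow>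
        (\<lambda>n. integral\<^sup>L (M n) f) \<longlonglongrightarrow> integral\<^sup>L L f)"

end

theory Submission
  imports Defs
begin

text \<open>The likelihood factors as a constant times \<open>exp (- n |\<theta>|\<^sup>2 / 2)\<close> times the partition function of the
  posterior on the spins, whose logarithmic gradient is the posterior mean of \<open>\<Sum> w\<^sub>i X\<^sub>i\<close>. By assumption this
  gradient is uniformly within \<open>o(\<surd>n)\<close> of the gradient of \<open>\<Sum> ln cosh (\<theta> \<bullet> X\<^sub>i)\<close>, so over a step of length
  \<open>|h| / \<surd>n\<close> the two functions can be exchanged at the cost of \<open>o(1)\<close>. The remaining statistics are even in each
  \<open>X\<^sub>i\<close>; since the Ising spins only flip signs, their law is the one under i.i.d. \<open>N(\<theta>0, I)\<close> sampling. There a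
  third-order Taylor expansion of \<open>ln cosh\<close>, the law of large numbers and the central limit theorem apply.\<close>

section \<open>The standard normal distribution\<close>

text \<open>The quadratic term and the limiting variance agree because of an identity for X ~
  N(\<theta>0, I) and T = tanh (\<theta>0 \<bullet> X). Weighted by 1 - T, the density becomes even,
  so E[X T] = E[X] = \<theta>0; this centres the score. With T^2 = 1 - sech^2 the variance of u
  \<bullet> X T is then |u|^2 - E[(u \<bullet> X)^2 sech^2], the form of \<open>info0\<close>. The
  expansion produces the same number from another side: |h|^2 comes from the Gaussian factor and the
  sech^2 term from the second derivative of ln cosh. The posterior bias involves the Ising energy
  and is not sign-invariant in general, so its event keeps the dependent law under which it is
  assumed small; it meets the other events only in a final union bound. Convergence in law in R^d is
  obtained by smoothing test functions with a narrow Gaussian: a smoothed integral is an integral of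
  the characteristic function. Tightness comes from second moments, which the covariance of the
  score bounds uniformly in n.\<close>

lemma norm_sq_eq_sum_Basis: "(norm (x :: 'a::euclidean_space))\<^sup>2 = (\<Sum>b\<in>Basis. (b \<bullet> x)\<^sup>2)"
  unfolding power2_norm_eq_inner euclidean_inner[of x x] by (simp add: power2_eq_square inner_commute)

text \<open>The product form turns integrals against \<open>gauss_dens\<close> into products of
  one-dimensional ones by Fubini.\<close>

lemma gauss_dens_eq_prod:
  fixes z :: "real^'d"
  shows "gauss_dens z = (\<Prod>b\<in>Basis. std_normal_density (z \<bullet> b))"
proof -
  have "(\<Prod>b\<in>(Basis::(real^'d) set). std_normal_density (z \<bullet> b))
      = (\<Prod>b\<in>(Basis::(real^'d) set). 1 / sqrt (2*pi)) * (\<Prod>b\<in>Basis. exp (- (z \<bullet> b)\<^sup>2 / 2))"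
    unfolding prod.distrib[symmetric] by (simp add: std_normal_density_def)
  also have "(\<Prod>b\<in>Basis. exp (- (z \<bullet> b)\<^sup>2 / 2)) = exp (\<Sum>b\<in>Basis. - (z \<bullet> b)\<^sup>2 / 2)"
    by (simp add: exp_sum)
  also have "(\<Sum>b\<in>Basis. - (z \<bullet> b)\<^sup>2 / 2) = - (norm z)\<^sup>2 / 2"
    unfolding sum_divide_distrib[symmetric] sum_negf norm_sq_eq_sum_Basis by (simp add: inner_commute)
  also have "(\<Prod>b\<in>(Basis::(real^'d) set). 1 / sqrt (2*pi)) = (2 * pi) powr (- real CARD('d) / 2)"
  proof -
    have "1 / sqrt (2*pi) = (2*pi) powr (-1/2)"
      by (simp add: powr_half_sqrt[symmetric] powr_minus_divide)
    hence "(\<Prod>b\<in>(Basis::(real^'d) set). 1 / sqrt (2*pi)) = ((2*pi) powr (-1/2)) ^ CARD('d)"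
      by simp
    also have "\<dots> = (2*pi) powr (- real CARD('d) / 2)"
      by (subst powr_realpow[symmetric]) (simp_all add: powr_powr)
    finally show ?thesis .
  qed
  finally show ?thesis by (simp add: gauss_dens_def)
qed

lemma gauss_dens_pos: "0 < gauss_dens z"
  by (simp add: gauss_dens_def)

lemma gauss_dens_nonneg [simp]: "0 \<le> gauss_dens z"
  using gauss_dens_pos[of z] by simp

lemma gauss_dens_uminus [simp]: "gauss_dens (- z) = gauss_dens z"
  by (simp add: gauss_dens_def)

lemma borel_measurable_gauss_dens [measurable]: "gauss_dens \<in> borel_measurable borel"
  unfolding gauss_dens_def by measurable

lemma prob_space_std_mvnormal: "prob_space (std_mvnormal :: (real^'d) measure)"
proof
  have "emeasure (std_mvnormal :: (real^'d) measure) (space std_mvnormal)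
      = (\<integral>\<^sup>+z. ennreal (gauss_dens (z::real^'d)) \<partial>lborel)"
    by (simp add: std_mvnormal_def emeasure_density)
  also have "\<dots> = (\<integral>\<^sup>+z. (\<Prod>b\<in>Basis. ennreal (std_normal_density ((z::real^'d) \<bullet> b))) \<partial>lborel)"
    by (simp add: gauss_dens_eq_prod prod_ennreal)
  also have "\<dots> = (\<Prod>b\<in>(Basis::(real^'d) set). (\<integral>\<^sup>+x. ennreal (std_normal_density x) \<partial>lborel))"
    by (subst nn_integral_lborel_prod) auto
  also have "(\<integral>\<^sup>+x. ennreal (std_normal_density x) \<partial>lborel) = 1"
    using prob_space.emeasure_space_1[OF prob_space_normal_density[of 1 0]]
    by (simp add: emeasure_density)
  finally show "emeasure (std_mvnormal :: (real^'d) measure) (space std_mvnormal) = 1" by simp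
qed

interpretation std_mvnormal: prob_space "std_mvnormal :: (real^'d) measure"
  by (rule prob_space_std_mvnormal)

lemma space_std_mvnormal [simp]: "space std_mvnormal = UNIV"
  by (simp add: std_mvnormal_def)

lemma sets_std_mvnormal [simp, measurable_cong]: "sets std_mvnormal = sets borel"
  by (simp add: std_mvnormal_def)

text \<open>Both the density and the character \<open>iexp (t \<bullet> z)\<close> factor over
  \<open>Basis\<close>, so the integral is a product of values of the characteristic function of
  \<open>std_normal_distribution\<close>.\<close>

lemma char_std_mvnormal:
  fixes t :: "real^'d"
  shows "(\<integral>z. iexp (t \<bullet> z) \<partial>std_mvnormal) = exp (- (norm t)\<^sup>2 / 2)"
proof -
  interpret L: product_sigma_finite "\<lambda>b::real^'d. lborel :: real measure" ..
  have int: "integrable lborel (\<lambda>x. std_normal_density x *\<^sub>R iexp (c * x))" for c :: real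
    by (rule Bochner_Integration.integrable_bound[where f="\<lambda>x. std_normal_density x"])
       (auto intro!: AE_I2)
  have one: "(\<integral>x. std_normal_density x *\<^sub>R iexp (c * x) \<partial>lborel) = of_real (exp (- c\<^sup>2 / 2))" for c :: real
  proof -
    have "(\<integral>x. std_normal_density x *\<^sub>R iexp (c * x) \<partial>lborel) = char std_normal_distribution c"
      unfolding char_def by (subst integral_density) auto
    thus ?thesis by (simp add: char_std_normal_distribution)
  qed
  have eq: "iexp (t \<bullet> z) = (\<Prod>b\<in>Basis. iexp ((t \<bullet> b) * (z \<bullet> b)))" for z :: "real^'d"
    by (subst euclidean_inner) (simp add: exp_sum sum_distrib_left)
  have "(\<integral>z. iexp (t \<bullet> z) \<partial>std_mvnormal) = (\<integral>z. gauss_dens z *\<^sub>R iexp (t \<bullet> z) \<partial>lborel)"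
    unfolding std_mvnormal_def by (subst integral_density) auto
  also have "\<dots> = (\<integral>z. (\<Prod>b\<in>Basis. std_normal_density (z \<bullet> b) *\<^sub>R iexp ((t \<bullet> b) * (z \<bullet> b))) \<partial>lborel)"
    unfolding gauss_dens_eq_prod eq by (simp add: scaleR_conv_of_real prod.distrib)
  also have "\<dots> = (\<integral>f. (\<Prod>b\<in>Basis. std_normal_density (f b) *\<^sub>R iexp ((t \<bullet> b) * f b)) \<partial>(\<Pi>\<^sub>M b\<in>(Basis::(real^'d) set). lborel))"
    by (subst lborel_eq, subst integral_distr) (auto intro!: Bochner_Integration.integral_cong prod.cong)
  also have "\<dots> = (\<Prod>b\<in>Basis. of_real (exp (- (t \<bullet> b)\<^sup>2 / 2)))"
    unfolding L.product_integral_prod[OF finite_Basis int] one ..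
  also have "\<dots> = of_real (exp (\<Sum>b\<in>Basis. - (t \<bullet> b)\<^sup>2 / 2))"
    by (simp add: exp_sum flip: exp_of_real)
  also have "(\<Sum>b\<in>Basis. - (t \<bullet> b)\<^sup>2 / 2) = - (norm t)\<^sup>2 / 2"
    unfolding sum_divide_distrib[symmetric] sum_negf norm_sq_eq_sum_Basis by (simp add: inner_commute)
  finally show ?thesis .
qed

text \<open>Both laws have characteristic function exp(-s^2 |t|^2 / 2) at s. This transfers the
  one-dimensional normal moments to every linear functional of z.\<close>

lemma distr_std_mvnormal_inner:
  fixes t :: "real^'d"
  shows "distr std_mvnormal borel (\<lambda>z. t \<bullet> z) = distr std_normal_distribution borel (\<lambda>r. norm t * r)"
proof (rule Levy_uniqueness)
  interpret S: prob_space std_normal_distribution by (rule prob_space_normal_density) simp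
  show "real_distribution (distr std_mvnormal borel (\<lambda>z. t \<bullet> z))" by simp
  show "real_distribution (distr std_normal_distribution borel (\<lambda>r. norm t * r))" by simp
  show "char (distr std_mvnormal borel (\<lambda>z. t \<bullet> z)) = char (distr std_normal_distribution borel (\<lambda>r. norm t * r))"
  proof
    fix s
    have "char (distr std_mvnormal borel (\<lambda>z. t \<bullet> z)) s = (\<integral>z. iexp ((s *\<^sub>R t) \<bullet> z) \<partial>std_mvnormal)"
      unfolding char_def by (subst integral_distr) auto
    also have "\<dots> = exp (- (s * norm t)\<^sup>2 / 2)"
      by (subst char_std_mvnormal) (simp add: power_mult_distrib)
    also have "\<dots> = char std_normal_distribution (s * norm t)"
      by (simp add: char_std_normal_distribution)
    also have "\<dots> = char (distr std_normal_distribution borel (\<lambda>r. norm t * r)) s"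
      unfolding char_def by (subst integral_distr) (auto simp: mult_ac)
    finally show "char (distr std_mvnormal borel (\<lambda>z. t \<bullet> z)) s = char (distr std_normal_distribution borel (\<lambda>r. norm t * r)) s" .
  qed
qed

lemma integrable_std_mvnormal_abs_inner_pow:
  fixes t :: "real^'d"
  shows "integrable std_mvnormal (\<lambda>z. \<bar>t \<bullet> z\<bar> ^ k)"
proof -
  have "integrable std_normal_distribution (\<lambda>r. \<bar>r\<bar> ^ k)"
    by (subst integrable_density) (auto simp: integrable_std_normal_moment_abs)
  hence "integrable std_normal_distribution (\<lambda>r. norm t ^ k * \<bar>r\<bar> ^ k)" by simp
  hence "integrable (distr std_normal_distribution borel (\<lambda>r. norm t * r)) (\<lambda>r. \<bar>r\<bar> ^ k)"
    by (subst integrable_distr_eq) (auto simp: abs_mult power_mult_distrib)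
  thus ?thesis
    unfolding distr_std_mvnormal_inner[symmetric] by (subst (asm) integrable_distr_eq) auto
qed

lemma integral_std_mvnormal_inner:
  fixes t :: "real^'d"
  shows "(\<integral>z. t \<bullet> z \<partial>std_mvnormal) = 0"
proof -
  have "(\<integral>z. t \<bullet> z \<partial>std_mvnormal) = (\<integral>r. r \<partial>distr std_mvnormal borel (\<lambda>z. t \<bullet> z))"
    by (subst integral_distr) auto
  also have "\<dots> = (\<integral>r. norm t * r \<partial>std_normal_distribution)"
    unfolding distr_std_mvnormal_inner by (subst integral_distr) auto
  also have "\<dots> = 0"
    using integral_std_normal_distribution_moment_odd[of 1] by simp
  finally show ?thesis .
qed

lemma integral_std_mvnormal_inner_sq:
  fixes t :: "real^'d"
  shows "(\<integral>z. (t \<bullet> z)\<^sup>2 \<partial>std_mvnormal) = (norm t)\<^sup>2"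
proof -
  have "(\<integral>z. (t \<bullet> z)\<^sup>2 \<partial>std_mvnormal) = (\<integral>r. r\<^sup>2 \<partial>distr std_mvnormal borel (\<lambda>z. t \<bullet> z))"
    by (subst integral_distr) auto
  also have "\<dots> = (\<integral>r. (norm t)\<^sup>2 * r\<^sup>2 \<partial>std_normal_distribution)"
    unfolding distr_std_mvnormal_inner by (subst integral_distr) (auto simp: power_mult_distrib)
  also have "\<dots> = (norm t)\<^sup>2"
    using std_normal_distribution_even_moments(1)[of 1] by simp
  finally show ?thesis .
qed

section \<open>Characteristic functions and weak convergence\<close>

lemma integrable_std_mvnormal_norm_sq:
  "integrable (std_mvnormal :: (real^'d) measure) (\<lambda>z. (norm z)\<^sup>2)"
proof -
  have "integrable (std_mvnormal :: (real^'d) measure) (\<lambda>z. \<Sum>b\<in>Basis. \<bar>b \<bullet> z\<bar>\<^sup>2)"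
    by (intro Bochner_Integration.integrable_sum integrable_std_mvnormal_abs_inner_pow)
  thus ?thesis by (simp add: norm_sq_eq_sum_Basis)
qed

text \<open>Displacements \<sigma>|z| below \<delta> cost at most e / 2 by uniform continuity.
  Larger ones cost at most 2B, which is dominated by 2B (\<sigma>|z| / \<delta>)^2; the integral of
  this Chebyshev term is made small through \<sigma>.\<close>

lemma gaussian_smoothing_uniformly_close:
  fixes g :: "real^'d \<Rightarrow> real"
  assumes cont: "continuous_on UNIV g" and B: "\<And>x. \<bar>g x\<bar> \<le> B"
    and supp: "\<forall>x. norm x > R \<longrightarrow> g x = 0" and e: "e > 0"
  shows "\<exists>\<sigma>>0. \<forall>x. \<bar>g x - (\<integral>z. g (x + \<sigma> *\<^sub>R z) \<partial>std_mvnormal)\<bar> \<le> e"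
proof -
  have [measurable]: "g \<in> borel_measurable borel"
    by (rule borel_measurable_continuous_onI[OF cont])
  have B0: "B \<ge> 0" using B[of 0] by linarith
  have "uniformly_continuous_on (cball 0 (R + 1)) g"
    by (rule compact_uniformly_continuous) (auto intro: continuous_on_subset[OF cont])
  then obtain \<delta>' where \<delta>': "\<delta>' > 0"
    "\<And>a b. a \<in> cball 0 (R+1) \<Longrightarrow> b \<in> cball 0 (R+1) \<Longrightarrow> dist b a < \<delta>' \<Longrightarrow> dist (g b) (g a) < e / 2"
    unfolding uniformly_continuous_on_def using e by (meson half_gt_zero)
  \<comment> \<open>The cap at 1 leaves two cases for points closer than \<delta>: both lie in the
    ball of radius R + 1, where g is uniformly continuous, or both lie outside radius R, where g
    vanishes.\<close>
  define \<delta> where "\<delta> = min \<delta>' 1"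
  have \<delta>: "\<delta> > 0" using \<delta>' by (simp add: \<delta>_def)
  have close: "\<bar>g a - g b\<bar> \<le> e / 2" if "norm (a - b) < \<delta>" for a b
  proof (cases "norm a \<le> R + 1 \<and> norm b \<le> R + 1")
    case True
    then show ?thesis using \<delta>'(2)[of b a] that by (auto simp: dist_norm \<delta>_def)
  next
    case False
    have "\<bar>norm a - norm b\<bar> < 1"
      using norm_triangle_ineq3[of a b] that by (simp add: \<delta>_def)
    with False have "norm a > R" "norm b > R" by linarith+
    then show ?thesis using supp e by simp
  qed
  define V where "V = (\<integral>z. (norm z)\<^sup>2 \<partial>(std_mvnormal :: (real^'d) measure))"
  have V: "V \<ge> 0" unfolding V_def by simp
  \<comment> \<open>Solves 2B (\<sigma> / \<delta>)^2 V \<le> e / 2; the added 1 keeps the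
    denominator positive when B or V is zero.\<close>
  define \<sigma> where "\<sigma> = \<delta> * sqrt (e / 2 / (2 * B * V + 1))"
  have den: "2 * B * V + 1 > 0" using B0 V by (simp add: add_nonneg_pos)
  have \<sigma>: "\<sigma> > 0" unfolding \<sigma>_def using \<delta> e den by simp
  have \<sigma>2: "2 * B * (\<sigma>\<^sup>2 / \<delta>\<^sup>2) * V \<le> e / 2"
  proof -
    have "\<sigma>\<^sup>2 / \<delta>\<^sup>2 = e / 2 / (2 * B * V + 1)"
      unfolding \<sigma>_def using \<delta> e den by (simp add: power_mult_distrib)
    moreover have "2 * B * (e / 2 / D) * V = (e / 2) * ((2 * B * V) / D)" for D :: real by simp
    ultimately have "2 * B * (\<sigma>\<^sup>2 / \<delta>\<^sup>2) * V = (e / 2) * ((2 * B * V) / (2 * B * V + 1))" by metis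
    also have "\<dots> \<le> e / 2 * 1"
      by (intro mult_left_mono) (use e den in \<open>auto simp: divide_le_eq\<close>)
    finally show ?thesis by simp
  qed
  have "\<bar>g x - (\<integral>z. g (x + \<sigma> *\<^sub>R z) \<partial>std_mvnormal)\<bar> \<le> e" for x
  proof -
    have ig: "integrable std_mvnormal (\<lambda>z. g (x + \<sigma> *\<^sub>R z))"
      by (rule std_mvnormal.integrable_const_bound[of _ B]) (use B in auto)
    have "g x - (\<integral>z. g (x + \<sigma> *\<^sub>R z) \<partial>std_mvnormal) = (\<integral>z. g x - g (x + \<sigma> *\<^sub>R z) \<partial>std_mvnormal)"
      using ig by (simp add: std_mvnormal.prob_space[simplified])
    also have "\<bar>\<dots>\<bar> \<le> (\<integral>z. \<bar>g x - g (x + \<sigma> *\<^sub>R z)\<bar> \<partial>std_mvnormal)"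
      by (rule integral_abs_bound)
    also have "\<dots> \<le> (\<integral>z. e / 2 + 2 * B * (\<sigma>\<^sup>2 / \<delta>\<^sup>2) * (norm (z::real^'d))\<^sup>2 \<partial>std_mvnormal)"
    proof (rule integral_mono)
      show "integrable std_mvnormal (\<lambda>z. \<bar>g x - g (x + \<sigma> *\<^sub>R z)\<bar>)" using ig by simp
      show "integrable (std_mvnormal :: (real^'d) measure) (\<lambda>z. e / 2 + 2 * B * (\<sigma>\<^sup>2 / \<delta>\<^sup>2) * (norm z)\<^sup>2)"
        by (intro Bochner_Integration.integrable_add integrable_mult_right integrable_std_mvnormal_norm_sq) simp
      fix z :: "real^'d"
      show "\<bar>g x - g (x + \<sigma> *\<^sub>R z)\<bar> \<le> e / 2 + 2 * B * (\<sigma>\<^sup>2 / \<delta>\<^sup>2) * (norm z)\<^sup>2"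
      proof (cases "\<sigma> * norm z < \<delta>")
        case True
        hence "\<bar>g x - g (x + \<sigma> *\<^sub>R z)\<bar> \<le> e / 2"
          using close[of x "x + \<sigma> *\<^sub>R z"] \<sigma> by simp
        thus ?thesis using B0 by (smt (verit) divide_nonneg_nonneg mult_nonneg_nonneg zero_le_power2)
      next
        case False
        hence "1 \<le> \<sigma> * norm z / \<delta>" using \<delta> by simp
        hence "1 \<le> (\<sigma> * norm z / \<delta>)\<^sup>2" by simp
        hence "2 * B * 1 \<le> 2 * B * (\<sigma> * norm z / \<delta>)\<^sup>2"
          using B0 by (intro mult_left_mono) auto
        moreover have "\<bar>g x - g (x + \<sigma> *\<^sub>R z)\<bar> \<le> 2 * B"
          using B[of x] B[of "x + \<sigma> *\<^sub>R z"] by linarith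
        ultimately show ?thesis using e by (simp add: power_mult_distrib power_divide)
      qed
    qed
    also have "\<dots> = e / 2 + 2 * B * (\<sigma>\<^sup>2 / \<delta>\<^sup>2) * V"
      unfolding V_def
      by (subst Bochner_Integration.integral_add)
         (auto intro!: integrable_mult_right integrable_std_mvnormal_norm_sq
           simp only: integral_mult_right_zero lebesgue_integral_const std_mvnormal.prob_space
             std_mvnormal.integrable_const scaleR_one)
    also have "\<dots> \<le> e" using \<sigma>2 by simp
    finally show ?thesis .
  qed
  with \<sigma> show ?thesis by blast
qed

text \<open>The substitution y = x + \<sigma> z moves x out of g and into a Gaussian kernel, so that
  only the kernel has to be integrated against the varying measures.\<close>

lemma gaussian_smoothing_eq_convolution:
  fixes g :: "real^'d \<Rightarrow> real"
  assumes [measurable]: "g \<in> borel_measurable borel" and \<sigma>: "\<sigma> > 0"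
  shows "(\<integral>z. g (x + \<sigma> *\<^sub>R z) \<partial>std_mvnormal)
       = (\<integral>y. g y * (gauss_dens ((1 / \<sigma>) *\<^sub>R (y - x)) / \<sigma> ^ CARD('d)) \<partial>lborel)"
proof -
  have "(\<integral>y. g y * (gauss_dens ((1 / \<sigma>) *\<^sub>R (y - x)) / \<sigma> ^ CARD('d)) \<partial>lborel)
     = (\<integral>y. g y * (gauss_dens ((1 / \<sigma>) *\<^sub>R (y - x)) / \<sigma> ^ CARD('d))
          \<partial>density (distr lborel borel (\<lambda>z. x + \<sigma> *\<^sub>R z)) (\<lambda>_. \<bar>\<sigma>\<bar>^DIM(real^'d)))"
    using lborel_affine[of \<sigma> x] \<sigma> by (simp add: less_imp_neq[symmetric])
  also have "\<dots> = (\<integral>z. \<sigma> ^ CARD('d) * (g (x + \<sigma> *\<^sub>R z) * (gauss_dens z / \<sigma> ^ CARD('d))) \<partial>lborel)"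
    using \<sigma> by (subst integral_density, simp_all add: integral_distr)
  also have "\<dots> = (\<integral>z. gauss_dens z *\<^sub>R g (x + \<sigma> *\<^sub>R z) \<partial>lborel)"
    using \<sigma> by (simp add: mult_ac)
  also have "\<dots> = (\<integral>z. g (x + \<sigma> *\<^sub>R z) \<partial>std_mvnormal)"
    unfolding std_mvnormal_def by (subst integral_density) auto
  finally show ?thesis by simp
qed

text \<open>A Gaussian is its own Fourier transform: \<open>char_std_mvnormal\<close> read backwards
  writes the kernel as an average of characters, and Fubini then exposes the characteristic function
  of M.\<close>

lemma integral_gaussian_kernel:
  fixes M :: "(real^'d) measure"
  assumes "prob_space M" and [measurable_cong]: "sets M = sets borel"
  shows "complex_of_real (\<integral>x. exp (- (norm ((1 / \<sigma>) *\<^sub>R (y - x)))\<^sup>2 / 2) \<partial>M)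
       = (\<integral>z. iexp (((1 / \<sigma>) *\<^sub>R y) \<bullet> z) * (\<integral>x. iexp ((- (1 / \<sigma>) *\<^sub>R z) \<bullet> x) \<partial>M) \<partial>std_mvnormal)"
proof -
  interpret M: prob_space M by fact
  interpret P: pair_prob_space M "std_mvnormal :: (real^'d) measure" ..
  have "complex_of_real (\<integral>x. exp (- (norm ((1 / \<sigma>) *\<^sub>R (y - x)))\<^sup>2 / 2) \<partial>M)
      = (\<integral>x. (\<integral>z. iexp (((1 / \<sigma>) *\<^sub>R (y - x)) \<bullet> z) \<partial>std_mvnormal) \<partial>M)"
    unfolding char_std_mvnormal by simp
  also have "\<dots> = (\<integral>z. (\<integral>x. iexp (((1 / \<sigma>) *\<^sub>R (y - x)) \<bullet> z) \<partial>M) \<partial>std_mvnormal)"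
    by (subst P.Fubini_integral) (auto intro!: P.integrable_const_bound[of _ 1] simp: split_beta')
  also have "\<dots> = (\<integral>z. (\<integral>x. iexp (((1 / \<sigma>) *\<^sub>R y) \<bullet> z) * iexp ((- (1 / \<sigma>) *\<^sub>R z) \<bullet> x) \<partial>M) \<partial>std_mvnormal)"
    by (intro Bochner_Integration.integral_cong refl)
       (simp add: exp_add[symmetric] inner_diff_left algebra_simps inner_commute)
  finally show ?thesis by simp
qed

lemma integral_gaussian_smoothing:
  fixes M :: "(real^'d) measure" and g :: "real^'d \<Rightarrow> real"
  assumes "prob_space M" and [measurable_cong]: "sets M = sets borel"
    and [measurable]: "g \<in> borel_measurable borel" and B: "\<And>x. \<bar>g x\<bar> \<le> B"
    and supp: "\<forall>x. norm x > R \<longrightarrow> g x = 0" and \<sigma>: "\<sigma> > 0"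
  shows "(\<integral>x. (\<integral>z. g (x + \<sigma> *\<^sub>R z) \<partial>std_mvnormal) \<partial>M)
     = gauss_dens (0::real^'d) / \<sigma> ^ CARD('d)
       * (\<integral>y. g y * (\<integral>x. exp (- (norm ((1 / \<sigma>) *\<^sub>R (y - x)))\<^sup>2 / 2) \<partial>M) \<partial>lborel)"
proof -
  interpret M: prob_space M by fact
  interpret P: pair_sigma_finite M "lborel :: (real^'d) measure" ..
  define c where "c = gauss_dens (0::real^'d) / \<sigma> ^ CARD('d)"
  have kernel: "gauss_dens v / \<sigma> ^ CARD('d) = c * exp (- (norm v)\<^sup>2 / 2)" for v :: "real^'d"
    by (simp add: gauss_dens_def c_def)
  have B0: "B \<ge> 0" using B[of 0] by linarith
  \<comment> \<open>Compact support of g pays for Fubini against the infinite measure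
    \<open>lborel\<close>: the integrand is at most B on a strip of finite measure and zero
    elsewhere.\<close>
  have int: "integrable (M \<Otimes>\<^sub>M lborel) (\<lambda>(x, y). g y * exp (- (norm ((1 / \<sigma>) *\<^sub>R (y - x)))\<^sup>2 / 2))"
  proof (rule Bochner_Integration.integrable_bound)
    have "emeasure (M \<Otimes>\<^sub>M lborel) (space M \<times> cball (0::real^'d) R) < \<infinity>"
      by (subst lborel.emeasure_pair_measure_Times)
         (use emeasure_bounded_finite[OF bounded_cball[of "0::real^'d" R]] in \<open>simp_all add: M.emeasure_space_1\<close>)
    thus "integrable (M \<Otimes>\<^sub>M lborel) (\<lambda>p. B * indicator (space M \<times> cball (0::real^'d) R) p :: real)"
      by (intro integrable_mult_right integrable_real_indicator) auto
    show "AE p in M \<Otimes>\<^sub>M lborel. norm (case p of (x, y) \<Rightarrow> g y * exp (- (norm ((1 / \<sigma>) *\<^sub>R (y - x)))\<^sup>2 / 2))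
        \<le> norm (B * indicator (space M \<times> cball (0::real^'d) R) p :: real)"
    proof (rule AE_I2)
      fix p assume "p \<in> space (M \<Otimes>\<^sub>M (lborel :: (real^'d) measure))"
      then obtain x y where p: "p = (x, y)" "x \<in> space M" by (auto simp: space_pair_measure)
      show "norm (case p of (x, y) \<Rightarrow> g y * exp (- (norm ((1 / \<sigma>) *\<^sub>R (y - x)))\<^sup>2 / 2))
        \<le> norm (B * indicator (space M \<times> cball (0::real^'d) R) p :: real)"
      proof (cases "norm y > R")
        case True thus ?thesis using supp p by simp
      next
        case False
        have "\<bar>g y\<bar> * exp (- (norm ((1 / \<sigma>) *\<^sub>R (y - x)))\<^sup>2 / 2) \<le> B * 1"
          by (intro mult_mono B) (auto intro: B0)
        thus ?thesis using False p B0 by (simp add: abs_mult indicator_def)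
      qed
    qed
  qed (simp add: split_beta')
  have "(\<integral>x. (\<integral>z. g (x + \<sigma> *\<^sub>R z) \<partial>std_mvnormal) \<partial>M)
      = (\<integral>x. (\<integral>y. c * (g y * exp (- (norm ((1 / \<sigma>) *\<^sub>R (y - x)))\<^sup>2 / 2)) \<partial>lborel) \<partial>M)"
    unfolding gaussian_smoothing_eq_convolution[OF assms(3) \<sigma>] kernel by (simp only: mult.left_commute)
  also have "\<dots> = c * (\<integral>x. (\<integral>y. g y * exp (- (norm ((1 / \<sigma>) *\<^sub>R (y - x)))\<^sup>2 / 2) \<partial>lborel) \<partial>M)"
    by simp
  also have "(\<integral>x. (\<integral>y. g y * exp (- (norm ((1 / \<sigma>) *\<^sub>R (y - x)))\<^sup>2 / 2) \<partial>lborel) \<partial>M)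
     = (\<integral>y. (\<integral>x. g y * exp (- (norm ((1 / \<sigma>) *\<^sub>R (y - x)))\<^sup>2 / 2) \<partial>M) \<partial>lborel)"
    using P.Fubini_integral[OF int] by simp
  finally show ?thesis by (simp add: c_def)
qed

text \<open>Dominated convergence is applied twice: under \<open>std_mvnormal\<close> with bound 1,
  to pass from characteristic functions to the kernel integrals, and under \<open>lborel\<close>
  with bound B on the ball of radius R, to pass from these to the smoothed integrals.\<close>

lemma char_convergence_imp_smoothed_convergence:
  fixes M :: "nat \<Rightarrow> (real^'d) measure" and g :: "real^'d \<Rightarrow> real"
  assumes M: "\<And>n. prob_space (M n)" "\<And>n. sets (M n) = sets borel"
    and L: "prob_space L" "sets L = sets borel"
    and char: "\<And>t. (\<lambda>n. \<integral>x. iexp (t \<bullet> x) \<partial>M n) \<longlonglongrightarrow> (\<integral>x. iexp (t \<bullet> x) \<partial>L)"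
    and [measurable]: "g \<in> borel_measurable borel" and B: "\<And>x. \<bar>g x\<bar> \<le> B"
    and supp: "\<forall>x. norm x > R \<longrightarrow> g x = 0" and \<sigma>: "\<sigma> > 0"
  shows "(\<lambda>n. \<integral>x. (\<integral>z. g (x + \<sigma> *\<^sub>R z) \<partial>std_mvnormal) \<partial>M n)
     \<longlonglongrightarrow> (\<integral>x. (\<integral>z. g (x + \<sigma> *\<^sub>R z) \<partial>std_mvnormal) \<partial>L)"
proof -
  let ?K = "\<lambda>N y. \<integral>x. exp (- (norm ((1 / \<sigma>) *\<^sub>R (y - x)))\<^sup>2 / 2) \<partial>N"
  have meas: "(\<lambda>z. (\<integral>x. iexp ((- (1 / \<sigma>) *\<^sub>R z) \<bullet> x) \<partial>N)) \<in> borel_measurable std_mvnormal"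
    if "prob_space N" and [measurable_cong]: "sets N = sets borel" for N :: "(real^'d) measure"
  proof -
    interpret N: prob_space N by fact
    show ?thesis by measurable
  qed
  have measK: "?K N \<in> borel_measurable lborel"
    if "prob_space N" and [measurable_cong]: "sets N = sets borel" for N :: "(real^'d) measure"
  proof -
    interpret N: prob_space N by fact
    show ?thesis by measurable
  qed
  have K01: "\<bar>?K N y\<bar> \<le> 1" if "prob_space N" "sets N = sets borel" for N and y :: "real^'d"
  proof -
    interpret N: prob_space N by fact
    note that(2)[measurable_cong]
    have "?K N y \<le> (\<integral>x. 1 \<partial>N)"
      by (rule integral_mono) (auto intro!: N.integrable_const_bound[of _ 1])
    thus ?thesis by (simp add: N.prob_space abs_of_nonneg)
  qed
  have lim: "(\<lambda>n. ?K (M n) y) \<longlonglongrightarrow> ?K L y" for y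
  proof -
    have "(\<lambda>n. complex_of_real (?K (M n) y)) \<longlonglongrightarrow> complex_of_real (?K L y)"
      unfolding integral_gaussian_kernel[OF M] integral_gaussian_kernel[OF L]
    proof (rule integral_dominated_convergence[where w="\<lambda>_. 1"])
      show "AE z in std_mvnormal. (\<lambda>n. iexp (((1 / \<sigma>) *\<^sub>R y) \<bullet> z) * (\<integral>x. iexp ((- (1 / \<sigma>) *\<^sub>R z) \<bullet> x) \<partial>M n))
        \<longlonglongrightarrow> iexp (((1 / \<sigma>) *\<^sub>R y) \<bullet> z) * (\<integral>x. iexp ((- (1 / \<sigma>) *\<^sub>R z) \<bullet> x) \<partial>L)"
        by (intro AE_I2 tendsto_mult_left char)
      show "AE z in std_mvnormal. norm (iexp (((1 / \<sigma>) *\<^sub>R y) \<bullet> z) * (\<integral>x. iexp ((- (1 / \<sigma>) *\<^sub>R z) \<bullet> x) \<partial>M n)) \<le> 1" for n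
      proof (rule AE_I2)
        fix z :: "real^'d"
        interpret N: prob_space "M n" by (rule M)
        have "norm (\<integral>x. iexp ((- (1 / \<sigma>) *\<^sub>R z) \<bullet> x) \<partial>M n) \<le> (\<integral>x. norm (iexp ((- (1 / \<sigma>) *\<^sub>R z) \<bullet> x)) \<partial>M n)"
          by (rule integral_norm_bound)
        thus "norm (iexp (((1 / \<sigma>) *\<^sub>R y) \<bullet> z) * (\<integral>x. iexp ((- (1 / \<sigma>) *\<^sub>R z) \<bullet> x) \<partial>M n)) \<le> 1"
          by (simp add: norm_mult N.prob_space)
      qed
    qed (use meas[OF M] meas[OF L] in \<open>auto intro!: borel_measurable_times\<close>)
    thus ?thesis by (simp add: tendsto_of_real_iff)
  qed
  have "(\<lambda>n. \<integral>y. g y * ?K (M n) y \<partial>lborel) \<longlonglongrightarrow> (\<integral>y. g y * ?K L y \<partial>lborel)"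
  proof (rule integral_dominated_convergence[where w="\<lambda>y. B * indicator (cball 0 R) y"])
    show "integrable lborel (\<lambda>y. B * indicator (cball (0::real^'d) R) y :: real)"
      by (intro integrable_mult_right integrable_real_indicator emeasure_bounded_finite) auto
    show "AE y in lborel. (\<lambda>n. g y * ?K (M n) y) \<longlonglongrightarrow> g y * ?K L y"
      by (intro AE_I2 tendsto_mult_left lim)
    show "AE y in lborel. norm (g y * ?K (M n) y) \<le> B * indicator (cball 0 R) y" for n
    proof (rule AE_I2)
      fix y :: "real^'d"
      show "norm (g y * ?K (M n) y) \<le> B * indicator (cball 0 R) y"
      proof (cases "norm y > R")
        case False
        have "\<bar>g y\<bar> * \<bar>?K (M n) y\<bar> \<le> B * 1"
          by (intro mult_mono B K01 M) (use B[of 0] in auto)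
        thus ?thesis using False by (simp add: abs_mult indicator_def)
      qed (simp add: supp)
    qed
  qed (use measK[OF M] measK[OF L] in auto)
  thus ?thesis
    unfolding integral_gaussian_smoothing[OF M assms(6) B supp \<sigma>] integral_gaussian_smoothing[OF L assms(6) B supp \<sigma>]
    by (rule tendsto_mult_left)
qed

lemma abs_diff_less_via:
  fixes a b c d r :: real
  assumes "\<bar>a - b\<bar> \<le> r / 4" "\<bar>c - d\<bar> \<le> r / 4" "\<bar>b - d\<bar> < r / 2"
  shows "\<bar>a - c\<bar> < r"
  using assms by linarith

text \<open>The smoothing error is uniform in x, hence the same for all probability measures, so a
  single \<sigma> serves every \<open>M n\<close> and L.\<close>

lemma char_convergence_imp_compact_support_convergence:
  fixes M :: "nat \<Rightarrow> (real^'d) measure" and g :: "real^'d \<Rightarrow> real"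
  assumes M: "\<And>n. prob_space (M n)" "\<And>n. sets (M n) = sets borel"
    and L: "prob_space L" "sets L = sets borel"
    and char: "\<And>t. (\<lambda>n. \<integral>x. iexp (t \<bullet> x) \<partial>M n) \<longlonglongrightarrow> (\<integral>x. iexp (t \<bullet> x) \<partial>L)"
    and cont: "continuous_on UNIV g" and B: "\<And>x. \<bar>g x\<bar> \<le> B"
    and supp: "\<forall>x. norm x > R \<longrightarrow> g x = 0"
  shows "(\<lambda>n. \<integral>x. g x \<partial>M n) \<longlonglongrightarrow> (\<integral>x. g x \<partial>L)"
proof (rule LIMSEQ_I)
  fix r :: real assume r: "r > 0"
  have [measurable]: "g \<in> borel_measurable borel"
    by (rule borel_measurable_continuous_onI[OF cont])
  let ?s = "\<lambda>\<sigma> x. \<integral>z. g (x + \<sigma> *\<^sub>R z) \<partial>std_mvnormal"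
  obtain \<sigma> where \<sigma>: "\<sigma> > 0" and close: "\<And>x. \<bar>g x - ?s \<sigma> x\<bar> \<le> r / 4"
    using gaussian_smoothing_uniformly_close[OF cont B supp, of "r/4"] r by auto
  have diff: "\<bar>(\<integral>x. g x \<partial>N) - (\<integral>x. ?s \<sigma> x \<partial>N)\<bar> \<le> r / 4"
    if "prob_space N" and N[measurable_cong]: "sets N = sets borel" for N
  proof -
    interpret N: prob_space N by fact
    have sB: "\<bar>?s \<sigma> x\<bar> \<le> B + r / 4" for x using close[of x] B[of x] by linarith
    have 1: "integrable N g" by (rule N.integrable_const_bound[of _ B]) (use B in auto)
    have 2: "integrable N (?s \<sigma>)" by (rule N.integrable_const_bound[of _ "B + r/4"]) (use sB in auto)
    have "\<bar>(\<integral>x. g x \<partial>N) - (\<integral>x. ?s \<sigma> x \<partial>N)\<bar> = \<bar>\<integral>x. g x - ?s \<sigma> x \<partial>N\<bar>"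
      using 1 2 by simp
    also have "\<dots> \<le> (\<integral>x. \<bar>g x - ?s \<sigma> x\<bar> \<partial>N)" by (rule integral_abs_bound)
    also have "\<dots> \<le> (\<integral>x. r / 4 \<partial>N)" using 1 2 close by (intro integral_mono) auto
    finally show ?thesis by (simp add: N.prob_space)
  qed
  have "(\<lambda>n. \<integral>x. ?s \<sigma> x \<partial>M n) \<longlonglongrightarrow> (\<integral>x. ?s \<sigma> x \<partial>L)"
    by (rule char_convergence_imp_smoothed_convergence[OF M L char _ B supp \<sigma>]) auto
  from LIMSEQ_D[OF this, of "r/2"] r obtain n0 where
    n0: "\<And>n. n \<ge> n0 \<Longrightarrow> \<bar>(\<integral>x. ?s \<sigma> x \<partial>M n) - (\<integral>x. ?s \<sigma> x \<partial>L)\<bar> < r / 2" by auto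
  show "\<exists>n0. \<forall>n\<ge>n0. norm ((\<integral>x. g x \<partial>M n) - (\<integral>x. g x \<partial>L)) < r"
  proof (intro exI allI impI)
    fix n assume "n \<ge> n0"
    from diff[OF M, of n] diff[OF L] n0[OF this]
    show "norm ((\<integral>x. g x \<partial>M n) - (\<integral>x. g x \<partial>L)) < r"
      unfolding real_norm_def by (rule abs_diff_less_via)
  qed
qed

text \<open>Chebyshev's inequality in pointwise form: outside the ball of radius R the difference is
  at most 2B \<le> 2B |x|^2 / R^2. A second-moment bound thereby acts as tightness.\<close>

lemma truncation_error_le:
  fixes N :: "(real^'d) measure"
  assumes "prob_space N" and [measurable_cong]: "sets N = sets borel"
    and [measurable]: "f \<in> borel_measurable borel" "f' \<in> borel_measurable borel"
    and B: "\<And>x. \<bar>f x\<bar> \<le> B" "\<And>x. \<bar>f' x\<bar> \<le> B"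
    and eq: "\<forall>x. norm x \<le> R \<longrightarrow> f' x = f x" and R: "R > 0"
    and int: "integrable N (\<lambda>x. (norm x)\<^sup>2)" and C: "(\<integral>x. (norm x)\<^sup>2 \<partial>N) \<le> C"
  shows "\<bar>(\<integral>x. f x \<partial>N) - (\<integral>x. f' x \<partial>N)\<bar> \<le> 2 * B * C / R\<^sup>2"
proof -
  interpret N: prob_space N by fact
  have B0: "B \<ge> 0" using B(1)[of 0] by linarith
  have 1: "integrable N f" "integrable N f'"
    by (rule N.integrable_const_bound[of _ B]; use B in auto)+
  have "\<bar>(\<integral>x. f x \<partial>N) - (\<integral>x. f' x \<partial>N)\<bar> = \<bar>\<integral>x. f x - f' x \<partial>N\<bar>" using 1 by simp
  also have "\<dots> \<le> (\<integral>x. \<bar>f x - f' x\<bar> \<partial>N)" by (rule integral_abs_bound)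
  also have "\<dots> \<le> (\<integral>x. 2 * B / R\<^sup>2 * (norm x)\<^sup>2 \<partial>N)"
  proof (rule integral_mono)
    fix x :: "real^'d"
    show "\<bar>f x - f' x\<bar> \<le> 2 * B / R\<^sup>2 * (norm x)\<^sup>2"
    proof (cases "norm x \<le> R")
      case True thus ?thesis using eq B0 by simp
    next
      case False
      hence "1 \<le> (norm x / R)\<^sup>2" using R by simp
      hence "2 * B * 1 \<le> 2 * B * (norm x / R)\<^sup>2" using B0 by (intro mult_left_mono) auto
      thus ?thesis using B(1)[of x] B(2)[of x] by (simp add: power_divide)
    qed
  qed (use 1 int in auto)
  also have "\<dots> = 2 * B / R\<^sup>2 * (\<integral>x. (norm x)\<^sup>2 \<partial>N)" by simp
  also have "\<dots> \<le> 2 * B / R\<^sup>2 * C" using C B0 by (intro mult_left_mono) auto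
  finally show ?thesis by simp
qed

text \<open>A continuity theorem of Levy type in which the common second-moment bound C prevents
  mass from escaping; bounded test functions are cut off and reduced to compactly supported
  ones.\<close>

theorem weak_conv_vec_of_char_convergence:
  fixes M :: "nat \<Rightarrow> (real^'d) measure"
  assumes M: "\<And>n. prob_space (M n)" "\<And>n. sets (M n) = sets borel"
    and L: "prob_space L" "sets L = sets borel"
    and char: "\<And>t. (\<lambda>n. \<integral>x. iexp (t \<bullet> x) \<partial>M n) \<longlonglongrightarrow> (\<integral>x. iexp (t \<bullet> x) \<partial>L)"
    and int: "\<And>n. integrable (M n) (\<lambda>x. (norm x)\<^sup>2)" "\<And>n. (\<integral>x. (norm x)\<^sup>2 \<partial>M n) \<le> C"
    and intL: "integrable L (\<lambda>x. (norm x)\<^sup>2)" "(\<integral>x. (norm x)\<^sup>2 \<partial>L) \<le> C"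
  shows "weak_conv_vec M L"
  unfolding weak_conv_vec_def
proof (intro allI impI)
  fix f :: "real^'d \<Rightarrow> real"
  assume f: "continuous_on UNIV f \<and> bounded (range f)"
  hence cont: "continuous_on UNIV f" by simp
  from f obtain B where B: "\<And>x. \<bar>f x\<bar> \<le> B" by (auto simp: bounded_iff)
  have B0: "B \<ge> 0" using B[of 0] by linarith
  have C0: "C \<ge> 0" by (rule order_trans[OF _ intL(2)]) simp
  have [measurable]: "f \<in> borel_measurable borel"
    by (rule borel_measurable_continuous_onI[OF cont])
  show "(\<lambda>n. integral\<^sup>L (M n) f) \<longlonglongrightarrow> integral\<^sup>L L f"
  proof (rule LIMSEQ_I)
    fix r :: real assume r: "r > 0"
    \<comment> \<open>Makes the truncation error 2BC / R^2 at most r / 4; the added 1 keeps R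
      positive when B or C is zero.\<close>
    define R where "R = sqrt ((8 * B * C + 1) / r)"
    have R: "R > 0" unfolding R_def using r B0 C0 by (simp add: add_nonneg_pos)
    have small: "2 * B * C / R\<^sup>2 \<le> r / 4"
    proof -
      have p: "8 * B * C + 1 > 0" using B0 C0 by (simp add: add_nonneg_pos)
      have R2: "R\<^sup>2 = (8 * B * C + 1) / r" unfolding R_def using p r by simp
      have "2 * B * C / R\<^sup>2 = (r / 4) * (8 * B * C / (8 * B * C + 1))"
        unfolding R2 by simp
      also have "\<dots> \<le> r / 4 * 1" using r p by (intro mult_left_mono) (auto simp: divide_le_eq)
      finally show ?thesis by simp
    qed
    \<comment> \<open>Equal to 1 up to radius R, linear in the norm in between, and 0 from radius R
      + 1 on, so the truncated function stays continuous.\<close>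
    define cutoff where "cutoff x = max 0 (min 1 (R + 1 - norm x))" for x :: "real^'d"
    define f' where "f' x = f x * cutoff x" for x
    have cutoff_le: "\<bar>cutoff x\<bar> \<le> 1" for x by (auto simp: cutoff_def)
    have contf': "continuous_on UNIV f'"
      unfolding f'_def cutoff_def by (intro continuous_intros cont)
    have [measurable]: "f' \<in> borel_measurable borel"
      by (rule borel_measurable_continuous_onI[OF contf'])
    have B': "\<bar>f' x\<bar> \<le> B" for x
      using mult_mono[OF B cutoff_le, of x x] B0 by (simp add: f'_def abs_mult)
    have eq: "\<forall>x. norm x \<le> R \<longrightarrow> f' x = f x" by (simp add: f'_def cutoff_def)
    have "(\<lambda>n. \<integral>x. f' x \<partial>M n) \<longlonglongrightarrow> (\<integral>x. f' x \<partial>L)"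
      by (rule char_convergence_imp_compact_support_convergence[OF M L char contf' B', of "R + 1"])
         (simp add: f'_def cutoff_def)
    from LIMSEQ_D[OF this, of "r/2"] r obtain n0 where
      n0: "\<And>n. n \<ge> n0 \<Longrightarrow> \<bar>(\<integral>x. f' x \<partial>M n) - (\<integral>x. f' x \<partial>L)\<bar> < r / 2" by auto
    show "\<exists>n0. \<forall>n\<ge>n0. norm ((\<integral>x. f x \<partial>M n) - (\<integral>x. f x \<partial>L)) < r"
    proof (intro exI allI impI)
      fix n assume n: "n \<ge> n0"
      have "\<bar>(\<integral>x. f x \<partial>M n) - (\<integral>x. f' x \<partial>M n)\<bar> \<le> r / 4"
        by (rule order_trans[OF truncation_error_le[OF M _ _ B B' eq R int] small]) auto
      moreover have "\<bar>(\<integral>x. f x \<partial>L) - (\<integral>x. f' x \<partial>L)\<bar> \<le> r / 4"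
        by (rule order_trans[OF truncation_error_le[OF L _ _ B B' eq R intL] small]) auto
      ultimately show "norm ((\<integral>x. f x \<partial>M n) - (\<integral>x. f x \<partial>L)) < r"
        using n0[OF n] unfolding real_norm_def by (rule abs_diff_less_via)
    qed
  qed
qed

section \<open>Multivariate normal distributions\<close>

text \<open>Cholesky-type elimination: subtracting the rank-one matrix of a pivot row keeps the
  form nonnegative and clears that row and column.\<close>

lemma psd_sum_rank_one:
  fixes Q :: "'d::finite \<Rightarrow> 'd \<Rightarrow> real"
  assumes "finite S" "\<And>i j. Q i j = Q j i"
    and "\<And>u. 0 \<le> (\<Sum>i\<in>UNIV. \<Sum>j\<in>UNIV. u i * Q i j * u j)"
    and "\<And>i j. i \<notin> S \<Longrightarrow> Q i j = 0"
  shows "\<exists>v. \<forall>i j. Q i j = (\<Sum>s\<in>S. v s i * v s j)"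
  using assms
proof (induction S arbitrary: Q rule: finite_induct)
  case empty
  then show ?case by simp
next
  case (insert s S)
  note sym = insert.prems(1) and psd = insert.prems(2) and supp = insert.prems(3)
  \<comment> \<open>The form at u + c e_s, a quadratic polynomial in c; its nonnegativity for all c
    drives both cases below.\<close>
  have two: "(\<Sum>i\<in>UNIV. \<Sum>j\<in>UNIV. (u i + c * of_bool (i = s)) * Q i j * (u j + c * of_bool (j = s)))
     = (\<Sum>i\<in>UNIV. \<Sum>j\<in>UNIV. u i * Q i j * u j) + 2 * c * (\<Sum>i\<in>UNIV. u i * Q i s) + c\<^sup>2 * Q s s" for u c
  proof -
    have "(\<Sum>i\<in>UNIV. \<Sum>j\<in>UNIV. (u i + c * of_bool (i = s)) * Q i j * (u j + c * of_bool (j = s)))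
      = (\<Sum>i\<in>UNIV. \<Sum>j\<in>UNIV. u i * Q i j * u j + (if j = s then c * (u i * Q i s) else 0)
          + (if i = s then c * (Q s j * u j) else 0)
          + (if i = s then (if j = s then c\<^sup>2 * Q s s else 0) else 0))"
      by (intro sum.cong refl) (auto simp: algebra_simps power2_eq_square)
    also have "\<dots> = (\<Sum>i\<in>UNIV. \<Sum>j\<in>UNIV. u i * Q i j * u j) + (\<Sum>i\<in>UNIV. c * (u i * Q i s))
        + (\<Sum>j\<in>UNIV. c * (Q s j * u j)) + c\<^sup>2 * Q s s"
    proof -
      have "(\<Sum>i\<in>UNIV. \<Sum>j\<in>UNIV. if i = s then c * (Q s j * u j) else 0) = (\<Sum>j\<in>UNIV. c * (Q s j * u j))"
        by (subst sum.swap) simp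
      moreover have "(\<Sum>i\<in>UNIV. \<Sum>j\<in>UNIV. if i = s then (if j = s then c\<^sup>2 * Q s s else 0) else 0) = c\<^sup>2 * Q s s"
        by (subst sum.swap) simp
      ultimately show ?thesis by (simp add: sum.distrib)
    qed
    also have "(\<Sum>j\<in>UNIV. c * (Q s j * u j)) = (\<Sum>i\<in>UNIV. c * (u i * Q i s))"
      by (intro sum.cong refl) (simp add: sym[of s] mult_ac)
    finally show ?thesis by (simp add: sum_distrib_left[symmetric])
  qed
  have ge: "0 \<le> (\<Sum>i\<in>UNIV. \<Sum>j\<in>UNIV. u i * Q i j * u j) + 2 * c * (\<Sum>i\<in>UNIV. u i * Q i s) + c\<^sup>2 * Q s s" for u c
    unfolding two[symmetric] by (rule psd)
  have Qss: "Q s s \<ge> 0" using ge[of "\<lambda>_. 0" 1] by simp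
  show ?case
  proof (cases "Q s s = 0")
    case True
    have row: "Q k s = 0" for k
    proof (rule ccontr)
      assume nz: "Q k s \<noteq> 0"
      have del: "(\<Sum>i\<in>UNIV. of_bool (i = k) * Q i s) = Q k s" by (simp add: of_bool_def if_distrib[of "\<lambda>x. x * _"] cong: if_cong)
      define a where "a = (\<Sum>i\<in>UNIV. \<Sum>j\<in>UNIV. of_bool (i = k) * Q i j * of_bool (j = k))"
      have a: "0 \<le> a + 2 * c * Q k s" for c
        using ge[of "\<lambda>i. of_bool (i = k)" c] unfolding del a_def[symmetric] True by simp
      \<comment> \<open>With a zero pivot the form at e_k + c e_s is affine in c. If its slope did
        not vanish, this c would bring it down to a - |a| - 1 < 0.\<close>
      have "2 * (- (\<bar>a\<bar> + 1) / (2 * Q k s)) * Q k s = - (\<bar>a\<bar> + 1)" using nz by simp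
      with a[of "- (\<bar>a\<bar> + 1) / (2 * Q k s)"] show False by linarith
    qed
    have "\<exists>v. \<forall>i j. Q i j = (\<Sum>s\<in>S. v s i * v s j)"
    proof (rule insert.IH[OF sym psd])
      fix i j assume "i \<notin> S"
      then show "Q i j = 0" using supp[of i j] row[of j] sym[of s j] by (cases "i = s") auto
    qed
    then obtain v where v: "\<And>i j. Q i j = (\<Sum>s\<in>S. v s i * v s j)" by blast
    show ?thesis
    proof (intro exI[of _ "v(s := \<lambda>_. 0)"] allI)
      fix i j
      have "(\<Sum>t\<in>S. (v(s := \<lambda>_. 0)) t i * (v(s := \<lambda>_. 0)) t j) = (\<Sum>t\<in>S. v t i * v t j)"
        using insert.hyps by (intro sum.cong) auto
      then show "Q i j = (\<Sum>t\<in>insert s S. (v(s := \<lambda>_. 0)) t i * (v(s := \<lambda>_. 0)) t j)"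
        using insert.hyps v by simp
    qed
  next
    case False
    with Qss have pos: "Q s s > 0" by simp
    define w where "w i = Q i s / sqrt (Q s s)" for i
    define Q' where "Q' i j = Q i j - w i * w j" for i j
    have ww: "w i * w j = Q i s * Q j s / Q s s" for i j
      using pos by (simp add: w_def)
    have "\<exists>v. \<forall>i j. Q' i j = (\<Sum>s\<in>S. v s i * v s j)"
    proof (rule insert.IH)
      show "Q' i j = Q' j i" for i j by (simp add: Q'_def sym mult.commute)
      show "0 \<le> (\<Sum>i\<in>UNIV. \<Sum>j\<in>UNIV. u i * Q' i j * u j)" for u
      proof -
        define T where "T = (\<Sum>i\<in>UNIV. u i * Q i s)"
        have "(\<Sum>i\<in>UNIV. \<Sum>j\<in>UNIV. u i * (w i * w j) * u j) = T\<^sup>2 / Q s s"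
          unfolding ww T_def power2_eq_square sum_product
          by (simp add: sum_divide_distrib mult_ac)
        hence "(\<Sum>i\<in>UNIV. \<Sum>j\<in>UNIV. u i * Q' i j * u j) = (\<Sum>i\<in>UNIV. \<Sum>j\<in>UNIV. u i * Q i j * u j) - T\<^sup>2 / Q s s"
          by (simp add: Q'_def algebra_simps sum_subtractf)
        \<comment> \<open>The value c = -T / Q s s minimises the quadratic in c, and the minimum is
          exactly the form of Q' at u.\<close>
        also have "\<dots> \<ge> 0"
          using ge[of u "- T / Q s s"] pos unfolding T_def[symmetric]
          by (simp add: power_divide field_simps power2_eq_square)
        finally show ?thesis .
      qed
      show "Q' i j = 0" if "i \<notin> S" for i j
      proof (cases "i = s")
        case True
        thus ?thesis using pos by (simp add: Q'_def ww sym[of s j])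
      next
        case False
        thus ?thesis using supp[of i] that by (simp add: Q'_def ww)
      qed
    qed
    then obtain v where v: "\<And>i j. Q' i j = (\<Sum>s\<in>S. v s i * v s j)" by blast
    show ?thesis
    proof (intro exI[of _ "v(s := w)"] allI)
      fix i j
      have "(\<Sum>t\<in>S. (v(s := w)) t i * (v(s := w)) t j) = (\<Sum>t\<in>S. v t i * v t j)"
        using insert.hyps by (intro sum.cong) auto
      then show "Q i j = (\<Sum>t\<in>insert s S. (v(s := w)) t i * (v(s := w)) t j)"
        using insert.hyps v[of i j] by (simp add: Q'_def)
    qed
  qed
qed

lemma inner_matrix_vector_mult_sum:
  fixes Q :: "real^'d^'d"
  shows "u \<bullet> (Q *v u) = (\<Sum>i\<in>UNIV. \<Sum>j\<in>UNIV. u $ i * Q $ i $ j * u $ j)"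
  by (simp add: inner_vec_def matrix_vector_mult_def sum_distrib_left mult_ac)

text \<open>\<open>mvnormal\<close> selects its matrix with \<open>SOME\<close>, so existence of a
  factor is what gives the choice a meaning. The vectors \<open>v s\<close> from the elimination
  become the columns of B.\<close>

lemma psd_factorisation:
  fixes Q :: "real^'d^'d"
  assumes "transpose Q = Q" and "\<And>u. 0 \<le> u \<bullet> (Q *v u)"
  shows "\<exists>B :: real^'d^'d. B ** transpose B = Q"
proof -
  have "\<exists>v. \<forall>i j. Q $ i $ j = (\<Sum>s\<in>(UNIV :: 'd set). v s i * v s j)"
  proof (rule psd_sum_rank_one[of UNIV "\<lambda>i j. Q $ i $ j"])
    show "Q $ i $ j = Q $ j $ i" for i j
      using assms(1) by (metis transpose_def vec_lambda_beta)
    show "0 \<le> (\<Sum>i\<in>UNIV. \<Sum>j\<in>UNIV. u i * Q $ i $ j * u j)" for u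
      using assms(2)[of "\<chi> i. u i"] unfolding inner_matrix_vector_mult_sum by simp
  qed auto
  then obtain v where "\<And>i j. Q $ i $ j = (\<Sum>s\<in>(UNIV :: 'd set). v s i * v s j)" by blast
  hence "(\<chi> i s. v s i) ** transpose (\<chi> i s. v s i) = Q"
    by (simp add: matrix_matrix_mult_def transpose_def vec_eq_iff)
  thus ?thesis by blast
qed

text \<open>These facts hold for whichever factor is selected: t \<bullet> Bz is the inner product
  of z with B^T t, and |B^T t|^2 = t \<bullet> Qt depends on B only through B B^T.\<close>

lemma mvnormal_props:
  fixes Q :: "real^'d^'d"
  assumes "transpose Q = Q" and "\<And>u. 0 \<le> u \<bullet> (Q *v u)"
  shows "prob_space (mvnormal Q)" "sets (mvnormal Q) = sets borel"
    "\<And>t. (\<integral>x. iexp (t \<bullet> x) \<partial>mvnormal Q) = exp (- (t \<bullet> (Q *v t)) / 2)"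
    "integrable (mvnormal Q) (\<lambda>x. (norm x)\<^sup>2)"
proof -
  define B :: "real^'d^'d" where "B = (SOME B. B ** transpose B = Q)"
  have B: "B ** transpose B = Q"
    unfolding B_def by (rule someI_ex[OF psd_factorisation[OF assms]])
  have eq: "mvnormal Q = distr std_mvnormal borel (\<lambda>z. B *v z)"
    by (simp add: mvnormal_def B_def)
  have [measurable]: "(\<lambda>z. B *v z) \<in> borel_measurable borel"
    by (intro borel_measurable_continuous_onI continuous_intros)
  show "prob_space (mvnormal Q)" unfolding eq by (rule std_mvnormal.prob_space_distr) simp
  show "sets (mvnormal Q) = sets borel" by (simp add: eq)
  show "(\<integral>x. iexp (t \<bullet> x) \<partial>mvnormal Q) = exp (- (t \<bullet> (Q *v t)) / 2)" for t
  proof -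
    have "(\<integral>x. iexp (t \<bullet> x) \<partial>mvnormal Q) = (\<integral>z. iexp (t \<bullet> (B *v z)) \<partial>std_mvnormal)"
      unfolding eq by (subst integral_distr) auto
    also have "\<dots> = (\<integral>z. iexp ((transpose B *v t) \<bullet> z) \<partial>std_mvnormal)"
      by (simp only: dot_lmul_matrix[symmetric] vector_transpose_matrix transpose_matrix_vector)
    also have "\<dots> = exp (- (norm (transpose B *v t))\<^sup>2 / 2)" by (rule char_std_mvnormal)
    also have "(norm (transpose B *v t))\<^sup>2 = t \<bullet> (Q *v t)"
      unfolding power2_norm_eq_inner B[symmetric] matrix_vector_mul_assoc[symmetric]
      by (simp only: dot_lmul_matrix[symmetric] transpose_matrix_vector)
    finally show ?thesis .
  qed
  show "integrable (mvnormal Q) (\<lambda>x. (norm x)\<^sup>2)"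
  proof -
    have "(norm (B *v z))\<^sup>2 = (\<Sum>i\<in>UNIV. \<bar>row i B \<bullet> z\<bar>\<^sup>2)" for z
      unfolding norm_vec_def L2_set_def
      by (simp add: sum_nonneg matrix_vector_mult_def row_def inner_vec_def)
    hence "integrable std_mvnormal (\<lambda>z. (norm (B *v z))\<^sup>2)"
      by (simp only:) (intro Bochner_Integration.integrable_sum integrable_std_mvnormal_abs_inner_pow)
    thus ?thesis unfolding eq by (subst integrable_distr_eq) auto
  qed
qed

section \<open>Sums of independent coordinates\<close>

lemma iid_coordinate:
  fixes f :: "'a \<Rightarrow> 'b::{banach, second_countable_topology}"
  assumes "prob_space N" "integrable N f" "i < n"
  shows "integrable (PiM {..<n} (\<lambda>_. N)) (\<lambda>x. f (x i))"
    and "(\<integral>x. f (x i) \<partial>PiM {..<n} (\<lambda>_. N)) = (\<integral>x. f x \<partial>N)"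
proof -
  have d: "distr (PiM {..<n} (\<lambda>_. N)) N (\<lambda>x. x i) = N"
    using assms by (intro distr_PiM_component) auto
  have [measurable]: "(\<lambda>x. x i) \<in> PiM {..<n} (\<lambda>_. N) \<rightarrow>\<^sub>M N" using assms(3) by simp
  have "integrable (distr (PiM {..<n} (\<lambda>_. N)) N (\<lambda>x. x i)) f" by (simp add: d assms)
  then show "integrable (PiM {..<n} (\<lambda>_. N)) (\<lambda>x. f (x i))"
    by (rule integrable_distr[rotated]) measurable
  have "(\<integral>x. f x \<partial>N) = (\<integral>x. f x \<partial>distr (PiM {..<n} (\<lambda>_. N)) N (\<lambda>x. x i))" by (simp add: d)
  also have "\<dots> = (\<integral>x. f (x i) \<partial>PiM {..<n} (\<lambda>_. N))"
    using assms(2) by (subst integral_distr) auto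
  finally show "(\<integral>x. f (x i) \<partial>PiM {..<n} (\<lambda>_. N)) = (\<integral>x. f x \<partial>N)" ..
qed

text \<open>In the expanded square the off-diagonal products have mean zero by independence and
  centring, which leaves n equal diagonal terms.\<close>

lemma iid_sum_second_moment:
  fixes U :: "'a \<Rightarrow> real" and n :: nat
  assumes N: "prob_space N" and U: "integrable N U" "integrable N (\<lambda>x. (U x)\<^sup>2)" "(\<integral>x. U x \<partial>N) = 0"
  shows "integrable (PiM {..<n} (\<lambda>_. N)) (\<lambda>x. (\<Sum>i<n. U (x i))\<^sup>2)"
    and "(\<integral>x. (\<Sum>i<n. U (x i))\<^sup>2 \<partial>PiM {..<n} (\<lambda>_. N)) = real n * (\<integral>x. (U x)\<^sup>2 \<partial>N)"
proof -
  interpret P: product_prob_space "\<lambda>_::nat. N" by (rule product_prob_spaceI) (rule N)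
  let ?Q = "PiM {..<n} (\<lambda>_. N)"
  have sq: "(\<Sum>i<n. U (x i))\<^sup>2 = (\<Sum>i<n. \<Sum>j<n. U (x i) * U (x j))" for x :: "nat \<Rightarrow> 'a"
    by (simp add: power2_eq_square sum_product)
  have pair: "integrable ?Q (\<lambda>x. U (x i) * U (x j)) \<and>
      (\<integral>x. U (x i) * U (x j) \<partial>?Q) = (if i = j then (\<integral>x. (U x)\<^sup>2 \<partial>N) else 0)"
    if "i < n" "j < n" for i j
  proof (cases "i = j")
    case True
    with iid_coordinate[OF N U(2) that(1)] show ?thesis by (simp add: power2_eq_square)
  next
    case False
    \<comment> \<open>Pads U (x i) U (x j) with factors 1 to a product over all coordinates, the
      shape to which the product integral formula applies.\<close>
    define f where "f k x = (if k \<in> {i, j} then U x else 1)" for k x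
    have int: "integrable N (f k)" for k
      using U(1) prob_space.finite_measure[OF N]
      by (cases "k \<in> {i, j}") (simp_all add: f_def[abs_def] finite_measure.integrable_const)
    have eq: "(\<Prod>k<n. f k (x k)) = U (x i) * U (x j)" for x
    proof -
      have "(\<Prod>k<n. f k (x k)) = (\<Prod>k\<in>{i, j}. U (x k))"
        by (rule prod.mono_neutral_cong_right) (use that in \<open>auto simp: f_def\<close>)
      thus ?thesis using False by simp
    qed
    have "(\<Prod>k<n. \<integral>x. f k x \<partial>N) = 0"
      by (rule prod_zero) (use that U(3) in \<open>auto simp: f_def intro!: bexI[of _ i]\<close>)
    moreover have "integrable ?Q (\<lambda>x. \<Prod>k<n. f k (x k))"
      by (rule P.product_integrable_prod) (use int in auto)
    moreover have "(\<integral>x. (\<Prod>k<n. f k (x k)) \<partial>?Q) = (\<Prod>k<n. \<integral>x. f k x \<partial>N)"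
      by (rule P.product_integral_prod) (use int in auto)
    ultimately show ?thesis using False unfolding eq by simp
  qed
  show "integrable ?Q (\<lambda>x. (\<Sum>i<n. U (x i))\<^sup>2)"
    unfolding sq using pair by (intro Bochner_Integration.integrable_sum) auto
  have "(\<integral>x. (\<Sum>i<n. U (x i))\<^sup>2 \<partial>?Q) = (\<Sum>i<n. \<Sum>j<n. \<integral>x. U (x i) * U (x j) \<partial>?Q)"
    unfolding sq using pair
    by (subst Bochner_Integration.integral_sum, fastforce intro!: Bochner_Integration.integrable_sum,
        intro sum.cong refl, subst Bochner_Integration.integral_sum) auto
  also have "\<dots> = (\<Sum>i<n. \<Sum>j<n. if i = j then (\<integral>x. (U x)\<^sup>2 \<partial>N) else 0)"
    using pair by (intro sum.cong refl) auto
  also have "\<dots> = real n * (\<integral>x. (U x)\<^sup>2 \<partial>N)" by simp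
  finally show "(\<integral>x. (\<Sum>i<n. U (x i))\<^sup>2 \<partial>?Q) = real n * (\<integral>x. (U x)\<^sup>2 \<partial>N)" .
qed

section \<open>The central limit theorem for characteristic functions\<close>

lemma iid_char_sum:
  assumes N: "prob_space N" and [measurable]: "f \<in> borel_measurable N"
  shows "(\<integral>x. iexp (\<Sum>i<n. f (x i)) \<partial>PiM {..<n} (\<lambda>_. N)) = (\<integral>x. iexp (f x) \<partial>N) ^ n"
proof -
  interpret N: prob_space N by (rule N)
  interpret P: product_prob_space "\<lambda>_::nat. N" by (rule product_prob_spaceI) (rule N)
  have int: "integrable N (\<lambda>x. iexp (f x))"
    by (rule N.integrable_const_bound[of _ 1]) auto
  have "(\<integral>x. iexp (\<Sum>i<n. f (x i)) \<partial>PiM {..<n} (\<lambda>_. N))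
      = (\<integral>x. (\<Prod>i<n. iexp (f (x i))) \<partial>PiM {..<n} (\<lambda>_. N))"
    by (simp add: sum_distrib_left exp_sum)
  also have "\<dots> = (\<Prod>i<n. \<integral>x. iexp (f x) \<partial>N)"
    by (rule P.product_integral_prod[OF finite_lessThan int])
  finally show ?thesis by simp
qed

text \<open>With a third moment, \<phi>(1 / sqrt n) differs from 1 - v / (2n) by O(n^(-3/2)). The
  n-th powers of two numbers in the unit disc differ by at most n times as much, and (1 - v /
  (2n))^n tends to exp(-v / 2). The case v = 0, which occurs for the direction t = 0, is
  covered.\<close>

lemma char_power_tendsto_gaussian:
  fixes f :: "'a \<Rightarrow> real"
  assumes N: "prob_space N" and [measurable]: "f \<in> borel_measurable N"
    and mom: "\<And>k. k \<le> 3 \<Longrightarrow> integrable N (\<lambda>x. f x ^ k)"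
    and mean: "(\<integral>x. f x \<partial>N) = 0" and var: "(\<integral>x. (f x)\<^sup>2 \<partial>N) = v"
  shows "(\<lambda>n. (\<integral>x. iexp (f x / sqrt (real n)) \<partial>N) ^ n) \<longlonglongrightarrow> exp (- v / 2)"
proof -
  interpret N: prob_space N by (rule N)
  define \<phi> where "\<phi> s = (\<integral>x. iexp (s * f x) \<partial>N)" for s :: real
  \<comment> \<open>Collects the third-order term and the remainder behind it; their constants 1/6
    and 1/3 are rounded up to 1.\<close>
  define K where "K = \<bar>\<integral>x. f x ^ 3 \<partial>N\<bar> + (\<integral>x. \<bar>f x\<bar> ^ 3 \<partial>N)"
  have v0: "v \<ge> 0" unfolding var[symmetric] by simp
  have \<phi>_char: "\<phi> s = char (distr N borel f) s" for s
    unfolding \<phi>_def char_def by (subst integral_distr) auto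
  have \<phi>1: "norm (\<phi> s) \<le> 1" for s
    unfolding \<phi>_char by (intro real_distribution.cmod_char_le_1 N.real_distribution_distr) simp
  have approx: "norm (\<phi> s - complex_of_real (1 - s\<^sup>2 * v / 2)) \<le> \<bar>s\<bar> ^ 3 * K" for s
  proof -
    have atMost3: "{..3::nat} = {0, 1, 2, 3}" by auto
    \<comment> \<open>The expansion of \<open>char_approx1'\<close> runs up to order 3, so its cubic
      term is split off here and counted as error.\<close>
    define c where "c = (\<i> * s) ^ 3 / 6 * (\<integral>x. f x ^ 3 \<partial>N)"
    have S: "(\<Sum>k\<le>3. ((\<i> * s) ^ k / fact k) * (\<integral>x. f x ^ k \<partial>N)) = complex_of_real (1 - s\<^sup>2 * v / 2) + c"
      using mean var N.prob_space
      by (subst atMost3) (simp add: c_def fact_numeral power_mult_distrib)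
    have "norm (\<phi> s - (complex_of_real (1 - s\<^sup>2 * v / 2) + c)) \<le> 2 * \<bar>s\<bar> ^ 3 / fact 3 * (\<integral>x. \<bar>f x\<bar> ^ 3 \<partial>N)"
      unfolding \<phi>_char S[symmetric]
      by (rule N.char_approx1'[OF mom]) auto
    moreover have "norm c \<le> \<bar>s\<bar> ^ 3 / 6 * \<bar>\<integral>x. f x ^ 3 \<partial>N\<bar>"
      by (simp add: c_def norm_mult norm_divide norm_power)
    ultimately have "norm (\<phi> s - complex_of_real (1 - s\<^sup>2 * v / 2))
        \<le> \<bar>s\<bar> ^ 3 / 3 * (\<integral>x. \<bar>f x\<bar> ^ 3 \<partial>N) + \<bar>s\<bar> ^ 3 / 6 * \<bar>\<integral>x. f x ^ 3 \<partial>N\<bar>"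
      using norm_triangle_ineq[of "\<phi> s - (complex_of_real (1 - s\<^sup>2 * v / 2) + c)" c] by (simp add: fact_numeral algebra_simps)
    also have "\<dots> \<le> \<bar>s\<bar> ^ 3 * (\<integral>x. \<bar>f x\<bar> ^ 3 \<partial>N) + \<bar>s\<bar> ^ 3 * \<bar>\<integral>x. f x ^ 3 \<partial>N\<bar>"
      by (intro add_mono mult_right_mono) auto
    finally show ?thesis by (simp add: K_def algebra_simps)
  qed
  \<comment> \<open>The condition n \<ge> v / 4 gives 1 - v / (2n) \<ge> -1, which puts both bases
    in the unit disc for \<open>norm_power_diff\<close>.\<close>
  have main: "norm (\<phi> (1 / sqrt n) ^ n - complex_of_real ((1 + (- v / 2) / n) ^ n)) \<le> K / sqrt n"
    if n: "n > 0" "n \<ge> v / 4" for n :: nat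
  proof -
    have w: "\<bar>1 + (- v / 2) / n\<bar> \<le> 1" using n v0 by (simp add: abs_le_iff field_simps)
    have "norm (\<phi> (1 / sqrt n) ^ n - complex_of_real ((1 + (- v / 2) / n) ^ n))
        \<le> n * norm (\<phi> (1 / sqrt n) - complex_of_real (1 + (- v / 2) / n))"
      unfolding of_real_power by (rule norm_power_diff) (use \<phi>1 w in \<open>auto simp only: norm_of_real\<close>)
    also have "\<dots> \<le> n * (\<bar>1 / sqrt n\<bar> ^ 3 * K)"
    proof (intro mult_left_mono)
      have "1 + (- v / 2) / n = 1 - (1 / sqrt n)\<^sup>2 * v / 2"
        using n by (simp add: power_divide)
      then show "norm (\<phi> (1 / sqrt n) - complex_of_real (1 + (- v / 2) / n)) \<le> \<bar>1 / sqrt n\<bar> ^ 3 * K"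
        using approx[of "1 / sqrt n"] by (simp only:)
    qed simp
    also have "\<dots> = K / sqrt n"
    proof -
      have "\<bar>1 / sqrt n\<bar> ^ 3 = 1 / (n * sqrt n)"
        using n by (simp add: power3_eq_cube)
      thus ?thesis using n by simp
    qed
    finally show ?thesis .
  qed
  have lim: "(\<lambda>n. complex_of_real ((1 + (- v / 2) / real n) ^ n)) \<longlonglongrightarrow> complex_of_real (exp (- v / 2))"
    by (rule isCont_tendsto_compose [OF _ tendsto_exp_limit_sequentially]) auto
  have diff: "(\<lambda>n. \<phi> (1 / sqrt n) ^ n - complex_of_real ((1 + (- v / 2) / real n) ^ n)) \<longlonglongrightarrow> 0"
  proof (rule Lim_null_comparison)
    show "(\<lambda>n. K / sqrt (real n)) \<longlonglongrightarrow> 0"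
      by (intro tendsto_divide_0[OF tendsto_const] filterlim_at_top_imp_at_infinity
            filterlim_compose[OF sqrt_at_top filterlim_real_sequentially])
    show "\<forall>\<^sub>F n in sequentially. norm (\<phi> (1 / sqrt n) ^ n - complex_of_real ((1 + (- v / 2) / real n) ^ n)) \<le> K / sqrt n"
    proof (rule eventually_sequentiallyI)
      fix n assume "n \<ge> nat \<lceil>v / 4\<rceil> + 1"
      then show "norm (\<phi> (1 / sqrt n) ^ n - complex_of_real ((1 + (- v / 2) / real n) ^ n)) \<le> K / sqrt n"
        by (intro main) linarith+
    qed
  qed
  have "(\<lambda>n. \<phi> (1 / sqrt n) ^ n) \<longlonglongrightarrow> complex_of_real (exp (- v / 2))"
    using tendsto_add[OF diff lim] by simp
  thus ?thesis by (simp add: \<phi>_def)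
qed

section \<open>Moments of the score under a shifted normal law\<close>

text \<open>The law of a single observation whose spin is +1.\<close>

definition mvnormal_at :: "real^'d \<Rightarrow> (real^'d) measure" where
  "mvnormal_at \<theta> = density lborel (\<lambda>x. ennreal (gauss_dens (x - \<theta>)))"

lemma space_mvnormal_at [simp]: "space (mvnormal_at \<theta>) = UNIV"
  by (simp add: mvnormal_at_def)

lemma sets_mvnormal_at [simp, measurable_cong]: "sets (mvnormal_at \<theta>) = sets borel"
  by (simp add: mvnormal_at_def)

lemma mvnormal_at_eq_distr: "mvnormal_at \<theta> = distr std_mvnormal borel (\<lambda>z. \<theta> + z)"
proof -
  have "mvnormal_at \<theta> = density (distr lborel borel ((+) \<theta>)) (\<lambda>x. ennreal (gauss_dens (x - \<theta>)))"
    by (simp add: mvnormal_at_def lborel_distr_plus)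
  also have "\<dots> = distr std_mvnormal borel ((+) \<theta>)"
    unfolding std_mvnormal_def by (subst density_distr) auto
  finally show ?thesis .
qed

lemma prob_space_mvnormal_at: "prob_space (mvnormal_at \<theta>)"
  unfolding mvnormal_at_eq_distr by (rule std_mvnormal.prob_space_distr) simp

interpretation mvnormal_at: prob_space "mvnormal_at \<theta>"
  by (rule prob_space_mvnormal_at)

lemma add_power_le:
  fixes a b :: real
  assumes "a \<ge> 0" "b \<ge> 0"
  shows "(a + b) ^ k \<le> 2 ^ k * (a ^ k + b ^ k)"
proof -
  have "(a + b) ^ k \<le> (2 * max a b) ^ k" by (rule power_mono) (use assms in auto)
  also have "\<dots> = 2 ^ k * max a b ^ k" by (simp add: power_mult_distrib)
  also have "max a b ^ k \<le> a ^ k + b ^ k" using assms by (auto simp: max_def)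
  finally show ?thesis by simp
qed

lemma integrable_mvnormal_at_abs_inner_pow:
  "integrable (mvnormal_at \<theta>) (\<lambda>x. \<bar>u \<bullet> x\<bar> ^ k)"
proof -
  have "integrable std_mvnormal (\<lambda>z. \<bar>u \<bullet> (\<theta> + z)\<bar> ^ k)"
  proof (rule Bochner_Integration.integrable_bound)
    show "integrable std_mvnormal (\<lambda>z. 2 ^ k * (\<bar>u \<bullet> \<theta>\<bar> ^ k + \<bar>u \<bullet> z\<bar> ^ k))"
      by (intro integrable_mult_right Bochner_Integration.integrable_add integrable_std_mvnormal_abs_inner_pow) simp
    show "AE z in std_mvnormal. norm (\<bar>u \<bullet> (\<theta> + z)\<bar> ^ k) \<le> norm (2 ^ k * (\<bar>u \<bullet> \<theta>\<bar> ^ k + \<bar>u \<bullet> z\<bar> ^ k))"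
    proof (rule AE_I2)
      fix z
      have "\<bar>u \<bullet> (\<theta> + z)\<bar> ^ k \<le> (\<bar>u \<bullet> \<theta>\<bar> + \<bar>u \<bullet> z\<bar>) ^ k"
        by (intro power_mono) (auto simp: inner_add_right)
      also have "\<dots> \<le> 2 ^ k * (\<bar>u \<bullet> \<theta>\<bar> ^ k + \<bar>u \<bullet> z\<bar> ^ k)" by (rule add_power_le) auto
      finally show "norm (\<bar>u \<bullet> (\<theta> + z)\<bar> ^ k) \<le> norm (2 ^ k * (\<bar>u \<bullet> \<theta>\<bar> ^ k + \<bar>u \<bullet> z\<bar> ^ k))" by simp
    qed
  qed simp
  thus ?thesis unfolding mvnormal_at_eq_distr by (subst integrable_distr_eq) auto
qed

lemma integrable_mvnormal_at_inner: "integrable (mvnormal_at \<theta>) (\<lambda>x. u \<bullet> x)"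
  by (rule integrable_abs_cancel) (use integrable_mvnormal_at_abs_inner_pow[of \<theta> u 1] in simp_all)

lemma integrable_mvnormal_at_inner_sq: "integrable (mvnormal_at \<theta>) (\<lambda>x. (u \<bullet> x)\<^sup>2)"
  using integrable_mvnormal_at_abs_inner_pow[of \<theta> u 2] by simp

lemma integral_mvnormal_at_inner: "(\<integral>x. u \<bullet> x \<partial>mvnormal_at \<theta>) = u \<bullet> \<theta>"
proof -
  have i: "integrable std_mvnormal (\<lambda>z. u \<bullet> z)"
    by (rule integrable_abs_cancel) (use integrable_std_mvnormal_abs_inner_pow[of u 1] in simp_all)
  have "(\<integral>x. u \<bullet> x \<partial>mvnormal_at \<theta>) = (\<integral>z. u \<bullet> \<theta> + u \<bullet> z \<partial>std_mvnormal)"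
    unfolding mvnormal_at_eq_distr by (subst integral_distr) (auto simp: inner_add_right)
  also have "\<dots> = u \<bullet> \<theta> + (\<integral>z. u \<bullet> z \<partial>std_mvnormal)"
    using i by (subst Bochner_Integration.integral_add) (auto simp: std_mvnormal.prob_space[simplified])
  finally show ?thesis by (simp add: integral_std_mvnormal_inner)
qed

lemma integral_mvnormal_at_inner_sq: "(\<integral>x. (u \<bullet> x)\<^sup>2 \<partial>mvnormal_at \<theta>) = (norm u)\<^sup>2 + (u \<bullet> \<theta>)\<^sup>2"
proof -
  have i1: "integrable std_mvnormal (\<lambda>z. u \<bullet> z)"
    by (rule integrable_abs_cancel) (use integrable_std_mvnormal_abs_inner_pow[of u 1] in simp_all)
  have i2: "integrable std_mvnormal (\<lambda>z. (u \<bullet> z)\<^sup>2)"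
    using integrable_std_mvnormal_abs_inner_pow[of u 2] by simp
  have "(\<integral>x. (u \<bullet> x)\<^sup>2 \<partial>mvnormal_at \<theta>) = (\<integral>z. (u \<bullet> \<theta>)\<^sup>2 + ((u \<bullet> z)\<^sup>2 + 2 * (u \<bullet> \<theta>) * (u \<bullet> z)) \<partial>std_mvnormal)"
    unfolding mvnormal_at_eq_distr
    by (subst integral_distr) (auto simp: inner_add_right power2_sum algebra_simps)
  also have "\<dots> = (u \<bullet> \<theta>)\<^sup>2 + ((\<integral>z. (u \<bullet> z)\<^sup>2 \<partial>std_mvnormal) + 2 * (u \<bullet> \<theta>) * (\<integral>z. u \<bullet> z \<partial>std_mvnormal))"
    using i1 i2 by (subst Bochner_Integration.integral_add)
      (auto simp: std_mvnormal.prob_space[simplified])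
  finally show ?thesis by (simp add: integral_std_mvnormal_inner integral_std_mvnormal_inner_sq)
qed

section \<open>Reflection symmetry and the centring of the score\<close>

lemma distr_lborel_uminus: "distr lborel borel uminus = (lborel :: 'a::euclidean_space measure)"
proof -
  have "(lborel :: 'a measure) = density (distr lborel borel uminus) (\<lambda>_. 1 :: ennreal)"
    using lborel_affine[of "- 1" "0 :: 'a"] by simp
  thus ?thesis by (simp add: density_1)
qed

lemma integral_lborel_reflect:
  fixes f :: "real^'d \<Rightarrow> real"
  assumes [measurable]: "f \<in> borel_measurable borel"
  shows "(\<integral>x. f (- x) \<partial>lborel) = (\<integral>x. f x \<partial>lborel)"
proof -
  have "(\<integral>x. f x \<partial>lborel) = (\<integral>x. f x \<partial>distr lborel borel uminus)"
    by (simp only: distr_lborel_uminus)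
  also have "\<dots> = (\<integral>x. f (- x) \<partial>lborel)"
    by (simp add: integral_distr)
  finally show ?thesis ..
qed

lemma sech_sq_plus_tanh_sq: "(sech t)\<^sup>2 + (tanh t)\<^sup>2 = 1"
proof -
  have "(sech t)\<^sup>2 + (tanh t)\<^sup>2 = (1 + (sinh t)\<^sup>2) / (cosh t)\<^sup>2"
    by (simp add: sech_def tanh_def power_divide add_divide_distrib)
  also have "1 + (sinh t)\<^sup>2 = (cosh t)\<^sup>2" by (simp add: cosh_square_eq)
  finally show ?thesis by simp
qed

lemma sech_bounds: "0 < sech t" "sech t \<le> 1"
  using cosh_real_ge_1[of t] cosh_real_pos[of t] by (auto simp: sech_def)

lemma abs_tanh_le_1: "\<bar>tanh (t::real)\<bar> \<le> 1"
  using tanh_real_bounds[of t] by auto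

lemma borel_measurable_tanh [measurable]: "(tanh :: real \<Rightarrow> real) \<in> borel_measurable borel"
  by (intro borel_measurable_continuous_onI continuous_intros) auto

lemma borel_measurable_sech [measurable]: "sech \<in> borel_measurable borel"
  unfolding sech_def by (intro borel_measurable_continuous_onI continuous_intros) auto

text \<open>The tilted density satisfies \<open>gauss_dens (x - \<theta>) * (1 - tanh (\<theta> \<bullet> x)) \<propto> gauss_dens x * sech (\<theta> \<bullet> x)\<close>,
  an even function of \<open>x\<close>.\<close>

lemma gauss_dens_shift_one_minus_tanh:
  "gauss_dens (x - \<theta>) * (1 - tanh (\<theta> \<bullet> x)) = exp (- (norm \<theta>)\<^sup>2 / 2) * gauss_dens x * sech (\<theta> \<bullet> x)"
proof -
  define a where "a = \<theta> \<bullet> x"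
  have "gauss_dens (x - \<theta>) = exp (- (norm \<theta>)\<^sup>2 / 2) * gauss_dens x * exp a"
    unfolding gauss_dens_def power2_norm_eq_inner a_def
    by (simp add: inner_diff_left inner_diff_right inner_commute exp_add[symmetric] field_simps)
  moreover have "exp a * (1 - tanh a) = sech a"
  proof -
    have "1 - tanh a = (cosh a - sinh a) / cosh a"
      using cosh_real_nonzero[of a] by (simp add: tanh_def field_simps)
    also have "cosh a - sinh a = exp (- a)" by (rule cosh_minus_sinh)
    finally show ?thesis by (simp add: sech_def exp_minus)
  qed
  ultimately show ?thesis unfolding a_def by (simp add: mult.assoc)
qed

lemma integrable_mvnormal_at_inner_tanh:
  "integrable (mvnormal_at \<theta>) (\<lambda>x. (u \<bullet> x) * tanh (\<theta> \<bullet> x))"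
proof (rule Bochner_Integration.integrable_bound[OF integrable_mvnormal_at_inner[of \<theta> u]])
  show "AE x in mvnormal_at \<theta>. norm ((u \<bullet> x) * tanh (\<theta> \<bullet> x)) \<le> norm (u \<bullet> x)"
    using abs_tanh_le_1 by (intro AE_I2) (simp add: abs_mult mult_left_le)
qed simp

text \<open>The integrand of the difference from E[u \<bullet> X] is u \<bullet> x times an even
  function, hence odd with integral zero. So the factor tanh leaves the mean unchanged.\<close>

lemma integral_mvnormal_at_inner_tanh:
  "(\<integral>x. (u \<bullet> x) * tanh (\<theta> \<bullet> x) \<partial>mvnormal_at \<theta>) = u \<bullet> \<theta>"
proof -
  let ?e = "\<lambda>x. exp (- (norm \<theta>)\<^sup>2 / 2) * gauss_dens x * sech (\<theta> \<bullet> x)"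
  have "(\<integral>x. (u \<bullet> x) - (u \<bullet> x) * tanh (\<theta> \<bullet> x) \<partial>mvnormal_at \<theta>)
      = (\<integral>x. gauss_dens (x - \<theta>) *\<^sub>R ((u \<bullet> x) - (u \<bullet> x) * tanh (\<theta> \<bullet> x)) \<partial>lborel)"
    unfolding mvnormal_at_def by (subst integral_density) auto
  also have "\<dots> = (\<integral>x. (u \<bullet> x) * (gauss_dens (x - \<theta>) * (1 - tanh (\<theta> \<bullet> x))) \<partial>lborel)"
    by (intro Bochner_Integration.integral_cong refl) (simp add: algebra_simps)
  also have "\<dots> = (\<integral>x. (u \<bullet> x) * ?e x \<partial>lborel)"
    by (simp only: gauss_dens_shift_one_minus_tanh)
  also have "\<dots> = 0"
  proof -
    have "(\<integral>x. (u \<bullet> x) * ?e x \<partial>lborel) = (\<integral>x. (u \<bullet> - x) * ?e (- x) \<partial>lborel)"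
      by (subst integral_lborel_reflect[symmetric]) auto
    also have "\<dots> = - (\<integral>x. (u \<bullet> x) * ?e x \<partial>lborel)"
      by (simp add: sech_def)
    finally show ?thesis by simp
  qed
  finally show ?thesis
    using integrable_mvnormal_at_inner[of \<theta> u] integrable_mvnormal_at_inner_tanh[of \<theta> u]
    by (simp add: integral_mvnormal_at_inner)
qed

lemma integrable_mvnormal_at_inner_sq_sech:
  "integrable (mvnormal_at \<theta>) (\<lambda>x. (u \<bullet> x)\<^sup>2 * (sech (\<theta> \<bullet> x))\<^sup>2)"
proof (rule Bochner_Integration.integrable_bound[OF integrable_mvnormal_at_inner_sq[of \<theta> u]])
  show "AE x in mvnormal_at \<theta>. norm ((u \<bullet> x)\<^sup>2 * (sech (\<theta> \<bullet> x))\<^sup>2) \<le> norm ((u \<bullet> x)\<^sup>2)"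
    using sech_bounds by (intro AE_I2) (simp add: abs_mult mult_left_le power_le_one less_imp_le)
qed simp

text \<open>Gathers the entrywise integrals of \<open>info0\<close> into one; both the variance of
  the score and the curvature of the likelihood meet the matrix in this scalar form.\<close>

lemma info0_quadratic_form:
  "u \<bullet> (info0 \<theta> *v u) = (norm u)\<^sup>2 - (\<integral>x. (u \<bullet> x)\<^sup>2 * (sech (\<theta> \<bullet> x))\<^sup>2 \<partial>mvnormal_at \<theta>)"
proof -
  let ?s = "\<lambda>x. (sech (\<theta> \<bullet> x))\<^sup>2"
  define J where "J i j = (\<integral>x. (x $ i * x $ j) * ?s x \<partial>mvnormal_at \<theta>)" for i j
  have J: "(LINT x|lborel. gauss_dens (x - \<theta>) * (x $ i * x $ j) * ?s x) = J i j" for i j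
    unfolding J_def mvnormal_at_def by (subst integral_density) (auto simp: mult_ac)
  have int: "integrable (mvnormal_at \<theta>) (\<lambda>x. (x $ i * x $ j) * ?s x)" for i j
  proof (rule Bochner_Integration.integrable_bound)
    show "integrable (mvnormal_at \<theta>) (\<lambda>x. (axis i 1 \<bullet> x)\<^sup>2 + (axis j 1 \<bullet> x)\<^sup>2)"
      by (intro Bochner_Integration.integrable_add integrable_mvnormal_at_inner_sq)
    show "AE x in mvnormal_at \<theta>. norm ((x $ i * x $ j) * ?s x) \<le> norm ((axis i 1 \<bullet> x)\<^sup>2 + (axis j 1 \<bullet> x)\<^sup>2)"
    proof (rule AE_I2)
      fix x :: "real^'a"
      have "\<bar>x $ i * x $ j\<bar> * ?s x \<le> \<bar>x $ i * x $ j\<bar> * 1"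
        using sech_bounds[of "\<theta> \<bullet> x"] by (intro mult_left_mono power_le_one) auto
      also have "\<dots> \<le> (x $ i)\<^sup>2 + (x $ j)\<^sup>2"
        using sum_squares_bound[of "\<bar>x $ i\<bar>" "\<bar>x $ j\<bar>"] abs_ge_zero[of "x $ i * x $ j"]
        unfolding abs_mult power2_abs mult.assoc by linarith
      finally show "norm ((x $ i * x $ j) * ?s x) \<le> norm ((axis i 1 \<bullet> x)\<^sup>2 + (axis j 1 \<bullet> x)\<^sup>2)"
        by (simp add: abs_mult inner_axis')
    qed
  qed simp
  have "u \<bullet> (info0 \<theta> *v u) = u \<bullet> u - (\<Sum>i\<in>UNIV. \<Sum>j\<in>UNIV. u $ i * J i j * u $ j)"
    unfolding info0_def J
    by (simp add: matrix_vector_mult_diff_rdistrib inner_diff_right inner_matrix_vector_mult_sum)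
  also have "(\<Sum>i\<in>UNIV. \<Sum>j\<in>UNIV. u $ i * J i j * u $ j)
      = (\<integral>x. (\<Sum>i\<in>UNIV. \<Sum>j\<in>UNIV. u $ i * ((x $ i * x $ j) * ?s x) * u $ j) \<partial>mvnormal_at \<theta>)"
    unfolding J_def using int
    by (simp add: Bochner_Integration.integral_sum Bochner_Integration.integrable_sum)
  also have "\<dots> = (\<integral>x. (u \<bullet> x)\<^sup>2 * ?s x \<partial>mvnormal_at \<theta>)"
  proof (intro Bochner_Integration.integral_cong refl)
    fix x :: "real^'a"
    have "(u \<bullet> x)\<^sup>2 = (\<Sum>i\<in>UNIV. \<Sum>j\<in>UNIV. (u $ i * x $ i) * (u $ j * x $ j))"
      by (simp add: inner_vec_def power2_eq_square sum_product)
    then show "(\<Sum>i\<in>UNIV. \<Sum>j\<in>UNIV. u $ i * ((x $ i * x $ j) * ?s x) * u $ j) = (u \<bullet> x)\<^sup>2 * ?s x"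
      by (simp only: sum_distrib_right sum_distrib_left mult_ac)
  qed
  finally show ?thesis by (simp add: power2_norm_eq_inner)
qed

lemma transpose_info0: "transpose (info0 \<theta>) = info0 \<theta>"
  by (auto simp: transpose_def info0_def vec_eq_iff mat_def mult_ac)

text \<open>One summand of \<open>u \<bullet> score_stat\<close>, before division by sqrt n; see
  \<open>inner_score_stat\<close>.\<close>

definition centred_score :: "real^'d \<Rightarrow> real^'d \<Rightarrow> real^'d \<Rightarrow> real" where
  "centred_score \<theta> u x = (u \<bullet> x) * tanh (\<theta> \<bullet> x) - u \<bullet> \<theta>"

lemma borel_measurable_centred_score [measurable]: "centred_score \<theta> u \<in> borel_measurable borel"
  unfolding centred_score_def by measurable

lemma integral_centred_score: "(\<integral>x. centred_score \<theta> u x \<partial>mvnormal_at \<theta>) = 0"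
  unfolding centred_score_def using integrable_mvnormal_at_inner_tanh[of \<theta> u]
  by (simp add: integral_mvnormal_at_inner_tanh mvnormal_at.prob_space[simplified])

lemma integrable_centred_score_power: "integrable (mvnormal_at \<theta>) (\<lambda>x. centred_score \<theta> u x ^ k)"
proof (rule Bochner_Integration.integrable_bound)
  show "integrable (mvnormal_at \<theta>) (\<lambda>x. 2 ^ k * (\<bar>u \<bullet> x\<bar> ^ k + \<bar>u \<bullet> \<theta>\<bar> ^ k))"
    by (intro integrable_mult_right Bochner_Integration.integrable_add integrable_mvnormal_at_abs_inner_pow) simp
  show "AE x in mvnormal_at \<theta>. norm (centred_score \<theta> u x ^ k) \<le> norm (2 ^ k * (\<bar>u \<bullet> x\<bar> ^ k + \<bar>u \<bullet> \<theta>\<bar> ^ k))"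
  proof (rule AE_I2)
    fix x
    have "\<bar>centred_score \<theta> u x\<bar> \<le> \<bar>(u \<bullet> x) * tanh (\<theta> \<bullet> x)\<bar> + \<bar>u \<bullet> \<theta>\<bar>"
      unfolding centred_score_def by (rule abs_triangle_ineq4)
    also have "\<bar>(u \<bullet> x) * tanh (\<theta> \<bullet> x)\<bar> \<le> \<bar>u \<bullet> x\<bar>"
      using abs_tanh_le_1 by (simp add: abs_mult mult_left_le)
    finally have "\<bar>centred_score \<theta> u x\<bar> ^ k \<le> (\<bar>u \<bullet> x\<bar> + \<bar>u \<bullet> \<theta>\<bar>) ^ k"
      by (intro power_mono) auto
    also have "\<dots> \<le> 2 ^ k * (\<bar>u \<bullet> x\<bar> ^ k + \<bar>u \<bullet> \<theta>\<bar> ^ k)" by (rule add_power_le) auto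
    finally show "norm (centred_score \<theta> u x ^ k) \<le> norm (2 ^ k * (\<bar>u \<bullet> x\<bar> ^ k + \<bar>u \<bullet> \<theta>\<bar> ^ k))"
      by (simp add: power_abs)
  qed
qed simp

text \<open>After replacing tanh^2 by 1 - sech^2, the second moment brings in (u \<bullet>
  \<theta>)^2, the cross term -2 (u \<bullet> \<theta>)^2 and the square of the mean another (u
  \<bullet> \<theta>)^2; these cancel and leave the information.\<close>

lemma integral_centred_score_sq:
  "(\<integral>x. (centred_score \<theta> u x)\<^sup>2 \<partial>mvnormal_at \<theta>) = u \<bullet> (info0 \<theta> *v u)"
proof -
  have eq: "(centred_score \<theta> u x)\<^sup>2 = (u \<bullet> x)\<^sup>2 - (u \<bullet> x)\<^sup>2 * (sech (\<theta> \<bullet> x))\<^sup>2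
      - 2 * (u \<bullet> \<theta>) * ((u \<bullet> x) * tanh (\<theta> \<bullet> x)) + (u \<bullet> \<theta>)\<^sup>2" for x
  proof -
    have t: "(tanh (\<theta> \<bullet> x))\<^sup>2 = 1 - (sech (\<theta> \<bullet> x))\<^sup>2"
      using sech_sq_plus_tanh_sq[of "\<theta> \<bullet> x"] by simp
    show ?thesis unfolding centred_score_def power2_diff power_mult_distrib t by (simp add: algebra_simps)
  qed
  have "(\<integral>x. (centred_score \<theta> u x)\<^sup>2 \<partial>mvnormal_at \<theta>)
     = (\<integral>x. (u \<bullet> x)\<^sup>2 \<partial>mvnormal_at \<theta>) - (\<integral>x. (u \<bullet> x)\<^sup>2 * (sech (\<theta> \<bullet> x))\<^sup>2 \<partial>mvnormal_at \<theta>)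
      - 2 * (u \<bullet> \<theta>) * (\<integral>x. (u \<bullet> x) * tanh (\<theta> \<bullet> x) \<partial>mvnormal_at \<theta>) + (u \<bullet> \<theta>)\<^sup>2"
    unfolding eq
    using integrable_mvnormal_at_inner_sq[of \<theta> u] integrable_mvnormal_at_inner_sq_sech[of \<theta> u]
      integrable_mvnormal_at_inner_tanh[of \<theta> u]
    by (simp add: mvnormal_at.prob_space[simplified])
  also have "\<dots> = u \<bullet> (info0 \<theta> *v u)"
    unfolding integral_mvnormal_at_inner_sq integral_mvnormal_at_inner_tanh info0_quadratic_form
    by (simp add: power2_eq_square[of "u \<bullet> \<theta>"])
  finally show ?thesis .
qed

text \<open>A variance cannot be negative; with symmetry this makes
  \<open>mvnormal (info0 \<theta>)\<close> a genuine normal law.\<close>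

lemma info0_psd: "0 \<le> u \<bullet> (info0 \<theta> *v u)"
  unfolding integral_centred_score_sq[symmetric] by simp

section \<open>Sign-flip invariance of the model\<close>

text \<open>The restriction to \<open>{..<n}\<close> keeps the flipped sample extensional, hence
  inside \<open>sample_space n\<close>.\<close>

definition flip :: "nat \<Rightarrow> (nat \<Rightarrow> real) \<Rightarrow> (nat \<Rightarrow> real^'d) \<Rightarrow> nat \<Rightarrow> real^'d" where
  "flip n z x = (\<lambda>i\<in>{..<n}. z i *\<^sub>R x i)"

abbreviation iid_sample :: "real^'d \<Rightarrow> nat \<Rightarrow> (nat \<Rightarrow> real^'d) measure" where
  "iid_sample \<theta> n \<equiv> PiM {..<n} (\<lambda>_. mvnormal_at \<theta>)"

lemma finite_spins [simp]: "finite (spins n)"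
  unfolding spins_def by (intro finite_PiE) auto

lemma spins_nonempty [simp]: "spins n \<noteq> {}"
  unfolding spins_def by (simp add: PiE_eq_empty_iff)

lemma spins_cases: "z \<in> spins n \<Longrightarrow> i < n \<Longrightarrow> z i = - 1 \<or> z i = 1"
  unfolding spins_def by (auto simp: PiE_iff)

lemma spins_mult_self: "z \<in> spins n \<Longrightarrow> i < n \<Longrightarrow> z i * z i = 1"
  using spins_cases[of z n i] by auto

lemma ising_pmf_nonneg [simp]: "0 \<le> ising_pmf \<beta> A n z"
  unfolding ising_pmf_def by (intro divide_nonneg_nonneg sum_nonneg) auto

lemma ising_partition_pos: "0 < (\<Sum>z\<in>spins n. exp (ising_energy \<beta> A n z))"
  by (rule sum_pos) auto

lemma sum_ising_pmf: "(\<Sum>z\<in>spins n. ising_pmf \<beta> A n z) = 1"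
  unfolding ising_pmf_def sum_divide_distrib[symmetric]
  using ising_partition_pos[where n=n and \<beta>=\<beta> and A=A] by simp

lemma sets_iid_sample: "sets (iid_sample \<theta> n) = sets (sample_space n)"
  unfolding sample_space_def by (intro sets_PiM_cong) auto

lemma space_iid_sample: "space (iid_sample \<theta> n) = space (sample_space n)"
  by (rule sets_eq_imp_space_eq[OF sets_iid_sample])

lemma sets_model [simp, measurable_cong]: "sets (model \<beta> A \<theta> n) = sets (sample_space n)"
  by (simp add: model_def)

lemma space_model [simp]: "space (model \<beta> A \<theta> n) = space (sample_space n)"
  by (simp add: model_def)

lemma measurable_sample_coordinate [measurable (raw)]:
  "i < n \<Longrightarrow> (\<lambda>x. x i) \<in> borel_measurable (sample_space n)"
  unfolding sample_space_def
  using measurable_component_singleton[of i "{..<n}" "\<lambda>_. lborel"] by simp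

lemma borel_measurable_lik [measurable]: "lik \<beta> A n \<theta> \<in> borel_measurable (sample_space n)"
  unfolding lik_def by (intro borel_measurable_sum borel_measurable_times borel_measurable_prod) auto

section \<open>The law of the sample given the spins\<close>

lemma distr_mvnormal_at_scaleR:
  assumes "c = - 1 \<or> c = 1"
  shows "distr (mvnormal_at \<theta>) borel (\<lambda>x. c *\<^sub>R x) = mvnormal_at (c *\<^sub>R \<theta>)"
  using assms
proof
  assume "c = 1"
  then show ?thesis by (simp add: distr_id2)
next
  assume c: "c = - 1"
  have "mvnormal_at (- \<theta>) = density (distr lborel borel uminus) (\<lambda>x. ennreal (gauss_dens (x + \<theta>)))"
    unfolding mvnormal_at_def by (subst distr_lborel_uminus[symmetric]) simp
  also have "\<dots> = distr (density lborel (\<lambda>x. ennreal (gauss_dens (- x + \<theta>)))) borel uminus"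
    by (subst density_distr) auto
  also have "(\<lambda>x. ennreal (gauss_dens (- x + \<theta>))) = (\<lambda>x. ennreal (gauss_dens (x - \<theta>)))"
  proof
    fix x
    show "ennreal (gauss_dens (- x + \<theta>)) = ennreal (gauss_dens (x - \<theta>))"
      using gauss_dens_uminus[of "x - \<theta>"] by simp
  qed
  finally show ?thesis using c by (simp add: mvnormal_at_def)
qed

text \<open>The centre may vary with the coordinate because, given the spins z, observation i is
  centred at \<open>z i *\<^sub>R \<theta>\<close>. Agreement on boxes identifies the two
  measures.\<close>

lemma PiM_mvnormal_at_eq_density:
  "PiM {..<n} (\<lambda>i. mvnormal_at (t i)) = density (sample_space n) (\<lambda>x. ennreal (\<Prod>i<n. gauss_dens (x i - t i)))"
proof -
  interpret P: product_prob_space "\<lambda>i. mvnormal_at (t i)"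
    by (rule product_prob_spaceI) (rule prob_space_mvnormal_at)
  interpret L: product_sigma_finite "\<lambda>i::nat. lborel :: (real^'a) measure" ..
  have "density (sample_space n) (\<lambda>x. ennreal (\<Prod>i<n. gauss_dens (x i - t i))) = PiM {..<n} (\<lambda>i. mvnormal_at (t i))"
  proof (rule P.PiM_eqI)
    show "sets (density (sample_space n) (\<lambda>x. ennreal (\<Prod>i<n. gauss_dens (x i - t i))))
       = sets (PiM {..<n} (\<lambda>i. mvnormal_at (t i)))"
      unfolding sets_density sample_space_def by (intro sets_PiM_cong) auto
    fix A assume A: "\<And>i. i \<in> {..<n} \<Longrightarrow> A i \<in> sets (mvnormal_at (t i))"
    hence A': "A i \<in> sets borel" if "i < n" for i using that by simp
    have E: "Pi\<^sub>E {..<n} A \<in> sets (sample_space n)"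
      unfolding sample_space_def by (rule sets_PiM_I_finite) (use A' in auto)
    have "emeasure (density (sample_space n) (\<lambda>x. ennreal (\<Prod>i<n. gauss_dens (x i - t i)))) (Pi\<^sub>E {..<n} A)
       = (\<integral>\<^sup>+x. ennreal (\<Prod>i<n. gauss_dens (x i - t i)) * indicator (Pi\<^sub>E {..<n} A) x \<partial>sample_space n)"
      by (rule emeasure_density) (use E in auto)
    also have "\<dots> = (\<integral>\<^sup>+x. (\<Prod>i<n. ennreal (gauss_dens (x i - t i)) * indicator (A i) (x i)) \<partial>sample_space n)"
    proof (rule nn_integral_cong)
      fix x :: "nat \<Rightarrow> real^'a" assume "x \<in> space (sample_space n)"
      \<comment> \<open>Membership in the box also requires extensionality, which the product of
        indicators does not see.\<close>
      hence "x \<in> extensional {..<n}" by (simp add: sample_space_def space_PiM PiE_def)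
      hence "indicator (Pi\<^sub>E {..<n} A) x = (\<Prod>i<n. indicator (A i) (x i) :: ennreal)"
        by (cases "\<forall>i<n. x i \<in> A i") (auto simp: indicator_def PiE_iff intro!: prod_zero[symmetric])
      thus "ennreal (\<Prod>i<n. gauss_dens (x i - t i)) * indicator (Pi\<^sub>E {..<n} A) x
          = (\<Prod>i<n. ennreal (gauss_dens (x i - t i)) * indicator (A i) (x i))"
        by (simp add: prod.distrib prod_ennreal)
    qed
    also have "\<dots> = (\<Prod>i<n. \<integral>\<^sup>+x. ennreal (gauss_dens (x - t i)) * indicator (A i) x \<partial>lborel)"
      unfolding sample_space_def by (rule L.product_nn_integral_prod) (use A' in auto)
    also have "\<dots> = (\<Prod>i<n. emeasure (mvnormal_at (t i)) (A i))"
      unfolding mvnormal_at_def using A' by (intro prod.cong refl) (simp add: emeasure_density)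
    finally show "emeasure (density (sample_space n) (\<lambda>x. ennreal (\<Prod>i<n. gauss_dens (x i - t i)))) (Pi\<^sub>E {..<n} A)
       = (\<Prod>i<n. emeasure (mvnormal_at (t i)) (A i))" .
  qed simp
  thus ?thesis ..
qed

lemma measurable_flip [measurable]: "flip n z \<in> sample_space n \<rightarrow>\<^sub>M sample_space n"
proof -
  have "flip n z \<in> sample_space n \<rightarrow>\<^sub>M PiM {..<n} (\<lambda>_. lborel)"
    unfolding flip_def by (rule measurable_restrict) simp
  thus ?thesis by (simp add: sample_space_def)
qed

text \<open>The preimage of a box under a coordinatewise sign change is again a box, and reflecting
  N(\<theta>, I) gives N(-\<theta>, I). The resulting product is the law of the sample given
  z.\<close>

lemma distr_iid_sample_flip:
  assumes z: "z \<in> spins n"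
  shows "distr (iid_sample \<theta> n) (sample_space n) (flip n z) = PiM {..<n} (\<lambda>i. mvnormal_at (z i *\<^sub>R \<theta>))"
proof -
  interpret P: product_prob_space "\<lambda>i. mvnormal_at (z i *\<^sub>R \<theta>)"
    by (rule product_prob_spaceI) (rule prob_space_mvnormal_at)
  interpret N: product_prob_space "\<lambda>i::nat. mvnormal_at \<theta>"
    by (rule product_prob_spaceI) (rule prob_space_mvnormal_at)
  note sets_iid_sample[measurable_cong]
  show ?thesis
  proof (rule P.PiM_eqI)
    show "sets (distr (iid_sample \<theta> n) (sample_space n) (flip n z))
       = sets (PiM {..<n} (\<lambda>i. mvnormal_at (z i *\<^sub>R \<theta>)))"
      unfolding sets_distr sample_space_def by (intro sets_PiM_cong) auto
    fix A assume A: "\<And>i. i \<in> {..<n} \<Longrightarrow> A i \<in> sets (mvnormal_at (z i *\<^sub>R \<theta>))"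
    hence A'[measurable]: "A i \<in> sets borel" if "i < n" for i using that by simp
    have E: "Pi\<^sub>E {..<n} A \<in> sets (sample_space n)"
      unfolding sample_space_def by (rule sets_PiM_I_finite) (use A' in auto)
    define B where "B i = (\<lambda>x::real^'a. z i *\<^sub>R x) -` A i" for i
    have B: "B i \<in> sets borel" if "i < n" for i
      unfolding B_def by (rule measurable_sets_borel[OF _ A'[OF that]]) measurable
    have pre: "flip n z -` Pi\<^sub>E {..<n} A \<inter> space (iid_sample \<theta> n) = Pi\<^sub>E {..<n} B"
    proof (rule set_eqI)
      fix x :: "nat \<Rightarrow> real^'a"
      have "flip n z x \<in> Pi\<^sub>E {..<n} A \<longleftrightarrow> (\<forall>i<n. z i *\<^sub>R x i \<in> A i)"
        unfolding flip_def restrict_PiE_iff by blast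
      moreover have "x \<in> space (iid_sample \<theta> n) \<longleftrightarrow> x \<in> extensional {..<n}"
        by (simp add: space_PiM PiE_iff)
      ultimately show "x \<in> flip n z -` Pi\<^sub>E {..<n} A \<inter> space (iid_sample \<theta> n) \<longleftrightarrow> x \<in> Pi\<^sub>E {..<n} B"
        unfolding Int_iff vimage_eq PiE_iff B_def by blast
    qed
    have "emeasure (distr (iid_sample \<theta> n) (sample_space n) (flip n z)) (Pi\<^sub>E {..<n} A)
        = emeasure (iid_sample \<theta> n) (Pi\<^sub>E {..<n} B)"
      unfolding pre[symmetric] by (rule emeasure_distr) (use E in auto)
    also have "\<dots> = (\<Prod>i<n. emeasure (mvnormal_at \<theta>) (B i))"
      by (rule N.emeasure_PiM) (use B in auto)
    also have "\<dots> = (\<Prod>i<n. emeasure (mvnormal_at (z i *\<^sub>R \<theta>)) (A i))"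
    proof (intro prod.cong refl)
      fix i assume "i \<in> {..<n}"
      hence i: "i < n" by simp
      have m: "(\<lambda>x. z i *\<^sub>R x) \<in> mvnormal_at \<theta> \<rightarrow>\<^sub>M borel"
        by (rule borel_measurable_scaleR[OF borel_measurable_const]) (rule measurable_ident_sets, simp)
      show "emeasure (mvnormal_at \<theta>) (B i) = emeasure (mvnormal_at (z i *\<^sub>R \<theta>)) (A i)"
        unfolding distr_mvnormal_at_scaleR[OF spins_cases[OF z i], symmetric] B_def
        using A'[OF i] m by (subst emeasure_distr) auto
    qed
    finally show "emeasure (distr (iid_sample \<theta> n) (sample_space n) (flip n z)) (Pi\<^sub>E {..<n} A)
       = (\<Prod>i<n. emeasure (mvnormal_at (z i *\<^sub>R \<theta>)) (A i))" .
  qed simp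
qed

text \<open>Conditionally on the spins the sample is a coordinatewise sign flip of an i.i.d. one, so
  events that do not see the signs have the same probability under every prior on the spins.\<close>

lemma emeasure_model_flip_invariant:
  assumes E: "E \<in> sets (sample_space n)"
    and inv: "\<And>z x. z \<in> spins n \<Longrightarrow> x \<in> space (sample_space n) \<Longrightarrow> flip n z x \<in> E \<longleftrightarrow> x \<in> E"
  shows "emeasure (model \<beta> A \<theta> n) E = emeasure (iid_sample \<theta> n) E"
proof -
  let ?p = "\<lambda>z x. \<Prod>i<n. gauss_dens (x i - z i *\<^sub>R \<theta>)"
  note sets_iid_sample[measurable_cong] E[measurable]
  have [measurable]: "?p z \<in> borel_measurable (sample_space n)" for z
    by (intro borel_measurable_prod) auto
  have pz: "(\<integral>\<^sup>+x. ennreal (?p z x) * indicator E x \<partial>sample_space n) = emeasure (iid_sample \<theta> n) E"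
    if z: "z \<in> spins n" for z
  proof -
    have "(\<integral>\<^sup>+x. ennreal (?p z x) * indicator E x \<partial>sample_space n)
        = emeasure (density (sample_space n) (\<lambda>x. ennreal (?p z x))) E"
      by (rule emeasure_density[symmetric]) (use E in auto)
    also have "\<dots> = emeasure (distr (iid_sample \<theta> n) (sample_space n) (flip n z)) E"
      by (simp only: PiM_mvnormal_at_eq_density[symmetric] distr_iid_sample_flip[OF z])
    also have "\<dots> = emeasure (iid_sample \<theta> n) (flip n z -` E \<inter> space (iid_sample \<theta> n))"
      by (rule emeasure_distr) (use E in auto)
    also have "flip n z -` E \<inter> space (iid_sample \<theta> n) = E"
      using inv[OF z] sets.sets_into_space[OF E] by (auto simp: space_iid_sample)
    finally show ?thesis .
  qed
  have "emeasure (model \<beta> A \<theta> n) E = (\<integral>\<^sup>+x. ennreal (lik \<beta> A n \<theta> x) * indicator E x \<partial>sample_space n)"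
    unfolding model_def by (rule emeasure_density) (use E in auto)
  also have "\<dots> = (\<integral>\<^sup>+x. (\<Sum>z\<in>spins n. ennreal (ising_pmf \<beta> A n z) * (ennreal (?p z x) * indicator E x)) \<partial>sample_space n)"
    by (intro nn_integral_cong)
       (simp add: lik_def sum_distrib_right ennreal_mult prod_nonneg mult.assoc sum_ennreal[symmetric])
  also have "\<dots> = (\<Sum>z\<in>spins n. ennreal (ising_pmf \<beta> A n z) * (\<integral>\<^sup>+x. ennreal (?p z x) * indicator E x \<partial>sample_space n))"
    by (subst nn_integral_sum) (auto intro!: sum.cong nn_integral_cmult)
  also have "\<dots> = (\<Sum>z\<in>spins n. ennreal (ising_pmf \<beta> A n z)) * emeasure (iid_sample \<theta> n) E"
    unfolding sum_distrib_right by (intro sum.cong refl) (simp add: pz)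
  also have "(\<Sum>z\<in>spins n. ennreal (ising_pmf \<beta> A n z)) = 1"
    by (simp add: sum_ennreal sum_ising_pmf)
  finally show ?thesis by simp
qed

lemma prob_space_iid_sample: "prob_space (iid_sample \<theta> n)"
  by (rule prob_space_PiM) (rule prob_space_mvnormal_at)

text \<open>The whole space is sign-invariant, so its mass is inherited from the i.i.d. law.\<close>

lemma prob_space_model: "prob_space (model \<beta> A \<theta> n)"
proof
  have "emeasure (model \<beta> A \<theta> n) (space (sample_space n)) = emeasure (iid_sample \<theta> n) (space (sample_space n))"
    by (rule emeasure_model_flip_invariant) (auto dest: measurable_space[OF measurable_flip])
  thus "emeasure (model \<beta> A \<theta> n) (space (model \<beta> A \<theta> n)) = 1"
    using prob_space.emeasure_space_1[OF prob_space_iid_sample[of n \<theta>]] by (simp add: space_iid_sample)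
qed

lemma measure_model_flip_invariant:
  assumes "E \<in> sets (sample_space n)"
    and "\<And>z x. z \<in> spins n \<Longrightarrow> x \<in> space (sample_space n) \<Longrightarrow> flip n z x \<in> E \<longleftrightarrow> x \<in> E"
  shows "measure (model \<beta> A \<theta> n) E = measure (iid_sample \<theta> n) E"
  using emeasure_model_flip_invariant[OF assms] by (simp add: measure_def)

lemma distr_model_flip_invariant:
  assumes T [measurable]: "T \<in> sample_space n \<rightarrow>\<^sub>M K"
    and inv: "\<And>z x. z \<in> spins n \<Longrightarrow> T (flip n z x) = T x"
  shows "distr (model \<beta> A \<theta> n) K T = distr (iid_sample \<theta> n) K T"
proof (rule measure_eqI)
  note sets_iid_sample[measurable_cong]
  fix S assume "S \<in> sets (distr (model \<beta> A \<theta> n) K T)"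
  hence S [measurable]: "S \<in> sets K" by simp
  have "emeasure (model \<beta> A \<theta> n) (T -` S \<inter> space (sample_space n))
      = emeasure (iid_sample \<theta> n) (T -` S \<inter> space (sample_space n))"
    by (rule emeasure_model_flip_invariant) (auto simp: inv dest: measurable_space[OF measurable_flip])
  thus "emeasure (distr (model \<beta> A \<theta> n) K T) S = emeasure (distr (iid_sample \<theta> n) K T) S"
    by (simp add: emeasure_distr space_iid_sample)
qed simp

section \<open>The log-likelihood ratio\<close>

text \<open>The normalising constant of the posterior; \<theta> comes last because it is the
  variable of differentiation.\<close>

definition post_partition :: "real \<Rightarrow> (nat \<Rightarrow> nat \<Rightarrow> nat \<Rightarrow> real) \<Rightarrow> nat \<Rightarrow> (nat \<Rightarrow> real^'d) \<Rightarrow> real^'d \<Rightarrow> real" where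
  "post_partition \<beta> A n x \<theta> = (\<Sum>w\<in>spins n. exp (post_energy \<beta> A n \<theta> x w))"

text \<open>The vector inside the norm of the uniformity assumption, and at the same time the
  gradient of \<open>ln (post_partition \<beta> A n x \<theta>) - log_cosh_sum n x \<theta>\<close>
  in \<theta>.\<close>

definition post_bias :: "real \<Rightarrow> (nat \<Rightarrow> nat \<Rightarrow> nat \<Rightarrow> real) \<Rightarrow> nat \<Rightarrow> (nat \<Rightarrow> real^'d) \<Rightarrow> real^'d \<Rightarrow> real^'d" where
  "post_bias \<beta> A n x \<theta> = post_mean \<beta> A n \<theta> x - (\<Sum>i<n. tanh (\<theta> \<bullet> x i) *\<^sub>R x i)"

text \<open>Up to the constant n ln 2 this is ln of \<open>post_partition\<close> at \<beta> = 0,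
  where the sum over independent fair spins factors into terms 2 cosh (\<theta> \<bullet> x
  i).\<close>

definition log_cosh_sum :: "nat \<Rightarrow> (nat \<Rightarrow> real^'d) \<Rightarrow> real^'d \<Rightarrow> real" where
  "log_cosh_sum n x \<theta> = (\<Sum>i<n. ln (cosh (\<theta> \<bullet> x i)))"

lemma post_partition_pos: "0 < post_partition \<beta> A n x \<theta>"
  unfolding post_partition_def by (rule sum_pos) auto

text \<open>Since c^2 = 1, the term |\<theta>|^2 is the same for both spins and the sign survives
  only in the linear exponent.\<close>

lemma gauss_dens_shift:
  assumes "c * c = 1"
  shows "gauss_dens (x - c *\<^sub>R \<theta>) = gauss_dens x * exp (- (norm \<theta>)\<^sup>2 / 2) * exp (\<theta> \<bullet> (c *\<^sub>R x))"
proof -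
  have "(norm (x - c *\<^sub>R \<theta>))\<^sup>2 = (norm x)\<^sup>2 + (c * c) * (norm \<theta>)\<^sup>2 - 2 * (\<theta> \<bullet> (c *\<^sub>R x))"
    unfolding power2_norm_eq_inner
    by (simp add: inner_diff_left inner_diff_right inner_commute algebra_simps)
  hence "exp (- (norm (x - c *\<^sub>R \<theta>))\<^sup>2 / 2) = exp (- (norm x)\<^sup>2 / 2) * exp (- (norm \<theta>)\<^sup>2 / 2) * exp (\<theta> \<bullet> (c *\<^sub>R x))"
    unfolding assms exp_add[symmetric] by (simp add: field_simps)
  thus ?thesis by (simp add: gauss_dens_def)
qed

lemma lik_eq_post_partition:
  "lik \<beta> A n \<theta> x = (\<Prod>i<n. gauss_dens (x i)) / (\<Sum>z\<in>spins n. exp (ising_energy \<beta> A n z))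
     * exp (- real n * (norm \<theta>)\<^sup>2 / 2) * post_partition \<beta> A n x \<theta>"
proof -
  let ?E = "\<Sum>z\<in>spins n. exp (ising_energy \<beta> A n z)"
  have summand: "ising_pmf \<beta> A n z * (\<Prod>i<n. gauss_dens (x i - z i *\<^sub>R \<theta>))
      = (\<Prod>i<n. gauss_dens (x i)) / ?E * exp (- real n * (norm \<theta>)\<^sup>2 / 2) * exp (post_energy \<beta> A n \<theta> x z)"
    if z: "z \<in> spins n" for z
  proof -
    have "(\<Prod>i<n. gauss_dens (x i - z i *\<^sub>R \<theta>))
        = (\<Prod>i<n. gauss_dens (x i) * exp (- (norm \<theta>)\<^sup>2 / 2) * exp (\<theta> \<bullet> (z i *\<^sub>R x i)))"
      by (intro prod.cong refl gauss_dens_shift) (use spins_mult_self[OF z] in auto)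
    also have "\<dots> = (\<Prod>i<n. gauss_dens (x i)) * exp (- real n * (norm \<theta>)\<^sup>2 / 2) * exp (\<theta> \<bullet> (\<Sum>i<n. z i *\<^sub>R x i))"
      by (simp add: prod.distrib exp_of_nat_mult[symmetric] exp_sum[symmetric] inner_sum_right)
    finally show ?thesis
      by (simp add: ising_pmf_def post_energy_def exp_add)
  qed
  show ?thesis
    unfolding lik_def post_partition_def sum_distrib_left by (intro sum.cong refl summand)
qed

lemma ln_lik_ratio:
  "ln (lik \<beta> A n \<theta> x / lik \<beta> A n \<theta>' x)
     = ln (post_partition \<beta> A n x \<theta>) - ln (post_partition \<beta> A n x \<theta>')
       - real n * ((norm \<theta>)\<^sup>2 - (norm \<theta>')\<^sup>2) / 2"
proof -
  define K where "K = (\<Prod>i<n. gauss_dens (x i)) / (\<Sum>z\<in>spins n. exp (ising_energy \<beta> A n z))"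
  have K: "K > 0" unfolding K_def
    by (intro divide_pos_pos prod_pos ising_partition_pos) (auto intro: gauss_dens_pos)
  have "ln (lik \<beta> A n \<theta> x) = ln K - real n * (norm \<theta>)\<^sup>2 / 2 + ln (post_partition \<beta> A n x \<theta>)" for \<theta>
    unfolding lik_eq_post_partition K_def[symmetric]
    using K post_partition_pos[of \<beta> A n x \<theta>] by (simp add: ln_mult)
  moreover have "lik \<beta> A n \<theta> x \<noteq> 0" for \<theta>
    unfolding lik_eq_post_partition K_def[symmetric]
    using K post_partition_pos[of \<beta> A n x \<theta>] by simp
  ultimately show ?thesis by (simp add: ln_div) (simp add: field_simps)
qed

text \<open>The posterior is an exponential family in \<theta> with sufficient statistic \<Sum> w_i
  x_i, the Ising energy being free of \<theta>.\<close>

lemma ln_post_partition_has_derivative: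
  "((\<lambda>\<theta>. ln (post_partition \<beta> A n x \<theta>)) has_derivative (\<lambda>v. post_mean \<beta> A n \<theta> x \<bullet> v)) (at \<theta>)"
proof -
  let ?s = "\<lambda>w. \<Sum>i<n. w i *\<^sub>R x i"
  have "((\<lambda>\<theta>. post_partition \<beta> A n x \<theta>) has_derivative
      (\<lambda>v. \<Sum>w\<in>spins n. exp (post_energy \<beta> A n \<theta> x w) * (v \<bullet> ?s w))) (at \<theta>)"
    unfolding post_partition_def post_energy_def
    by (auto intro!: derivative_eq_intros simp: mult_ac)
  hence "((\<lambda>\<theta>. ln (post_partition \<beta> A n x \<theta>)) has_derivative
      (\<lambda>v. (\<Sum>w\<in>spins n. exp (post_energy \<beta> A n \<theta> x w) * (v \<bullet> ?s w)) * inverse (post_partition \<beta> A n x \<theta>))) (at \<theta>)"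
    using post_partition_pos[of \<beta> A n x \<theta>] by (auto intro!: derivative_eq_intros simp: divide_inverse)
  also have "(\<lambda>v. (\<Sum>w\<in>spins n. exp (post_energy \<beta> A n \<theta> x w) * (v \<bullet> ?s w)) * inverse (post_partition \<beta> A n x \<theta>))
      = (\<lambda>v. post_mean \<beta> A n \<theta> x \<bullet> v)"
    unfolding post_mean_def post_partition_def[symmetric]
  proof
    fix v
    have "(\<Sum>w\<in>spins n. exp (post_energy \<beta> A n \<theta> x w) * (v \<bullet> ?s w)) * inverse (post_partition \<beta> A n x \<theta>)
        = (\<Sum>w\<in>spins n. exp (post_energy \<beta> A n \<theta> x w) / post_partition \<beta> A n x \<theta> * (?s w \<bullet> v))"
      unfolding sum_distrib_right
      by (intro sum.cong refl) (simp only: inner_commute[of v] divide_inverse mult_ac)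
    then show "(\<Sum>w\<in>spins n. exp (post_energy \<beta> A n \<theta> x w) * (v \<bullet> ?s w)) * inverse (post_partition \<beta> A n x \<theta>)
        = (\<Sum>w\<in>spins n. (exp (post_energy \<beta> A n \<theta> x w) / post_partition \<beta> A n x \<theta>) *\<^sub>R ?s w) \<bullet> v"
      by (simp only: inner_sum_left inner_scaleR_left)
  qed
  finally show ?thesis .
qed

lemma log_cosh_sum_has_derivative:
  "(log_cosh_sum n x has_derivative (\<lambda>v. (\<Sum>i<n. tanh (\<theta> \<bullet> x i) *\<^sub>R x i) \<bullet> v)) (at \<theta>)"
proof -
  have "((\<lambda>t. ln (cosh t)) has_real_derivative tanh t) (at t)" for t :: real
    by (auto intro!: derivative_eq_intros simp: tanh_def divide_inverse)
  hence "((\<lambda>\<theta>. ln (cosh (\<theta> \<bullet> x i))) has_derivative (\<lambda>v. (v \<bullet> x i) * tanh (\<theta> \<bullet> x i))) (at \<theta>)" for i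
    by (rule DERIV_compose_FDERIV) (auto intro!: derivative_eq_intros)
  hence "((\<lambda>\<theta>. \<Sum>i<n. ln (cosh (\<theta> \<bullet> x i))) has_derivative
     (\<lambda>v. \<Sum>i<n. (v \<bullet> x i) * tanh (\<theta> \<bullet> x i))) (at \<theta>)"
    by (rule has_derivative_sum)
  thus ?thesis unfolding log_cosh_sum_def by (simp add: inner_sum_left inner_sum_right inner_commute mult.commute)
qed

section \<open>Bounds on the posterior bias uniform in the parameter\<close>

lemma norm_post_mean_le: "norm (post_mean \<beta> A n \<theta> x) \<le> (\<Sum>i<n. norm (x i))"
proof -
  let ?p = "\<lambda>w. exp (post_energy \<beta> A n \<theta> x w) / (\<Sum>w'\<in>spins n. exp (post_energy \<beta> A n \<theta> x w'))"
  have p0: "?p w \<ge> 0" for w by (intro divide_nonneg_nonneg sum_nonneg) auto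
  have "norm (post_mean \<beta> A n \<theta> x) \<le> (\<Sum>w\<in>spins n. norm (?p w *\<^sub>R (\<Sum>i<n. w i *\<^sub>R x i)))"
    unfolding post_mean_def by (rule norm_sum)
  also have "\<dots> \<le> (\<Sum>w\<in>spins n. ?p w * (\<Sum>i<n. norm (x i)))"
  proof (intro sum_mono)
    fix w assume w: "w \<in> spins n"
    have "norm (\<Sum>i<n. w i *\<^sub>R x i) \<le> (\<Sum>i<n. norm (w i *\<^sub>R x i))" by (rule norm_sum)
    also have "\<dots> = (\<Sum>i<n. norm (x i))"
      using spins_cases[OF w] by (intro sum.cong refl) fastforce
    finally have "norm (\<Sum>i<n. w i *\<^sub>R x i) \<le> (\<Sum>i<n. norm (x i))" .
    thus "norm (?p w *\<^sub>R (\<Sum>i<n. w i *\<^sub>R x i)) \<le> ?p w * (\<Sum>i<n. norm (x i))"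
      unfolding norm_scaleR abs_of_nonneg[OF p0] by (rule mult_left_mono[OF _ p0])
  qed
  also have "\<dots> = (\<Sum>i<n. norm (x i))"
    unfolding sum_distrib_right[symmetric] sum_divide_distrib[symmetric]
    using post_partition_pos[of \<beta> A n x \<theta>] by (simp add: post_partition_def)
  finally show ?thesis .
qed

text \<open>The bound is free of \<theta>: a real-valued \<open>SUP\<close> dominates its members
  only over a set that is bounded above.\<close>

lemma norm_post_bias_le: "norm (post_bias \<beta> A n x \<theta>) \<le> 2 * (\<Sum>i<n. norm (x i))"
proof -
  have "norm (\<Sum>i<n. tanh (\<theta> \<bullet> x i) *\<^sub>R x i) \<le> (\<Sum>i<n. norm (x i))"
    by (rule sum_norm_le) (use abs_tanh_le_1 in \<open>simp add: mult_left_le_one_le\<close>)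
  thus ?thesis
    unfolding post_bias_def
    using norm_post_mean_le[of \<beta> A n \<theta> x]
      norm_triangle_ineq4[of "post_mean \<beta> A n \<theta> x" "\<Sum>i<n. tanh (\<theta> \<bullet> x i) *\<^sub>R x i"] by linarith
qed

lemma norm_post_bias_le_SUP:
  assumes "\<theta> \<noteq> 0"
  shows "norm (post_bias \<beta> A n x \<theta>) \<le> (SUP \<theta>\<in>{\<theta>. \<theta> \<noteq> 0}. norm (post_bias \<beta> A n x \<theta>))"
  by (rule cSUP_upper) (use assms norm_post_bias_le in \<open>auto intro!: bdd_aboveI\<close>)

text \<open>Mean value inequality on the ball around \<open>\<theta>0\<close> that avoids the origin: the uniform posterior
  bias bounds the gradient of the difference of the two log partition functions.\<close>

lemma ln_lik_ratio_approx:
  assumes \<theta>: "norm (\<theta> - \<theta>0) < norm \<theta>0"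
  shows "\<bar>ln (lik \<beta> A n \<theta> x / lik \<beta> A n \<theta>0 x)
      - (log_cosh_sum n x \<theta> - log_cosh_sum n x \<theta>0 - real n * ((norm \<theta>)\<^sup>2 - (norm \<theta>0)\<^sup>2) / 2)\<bar>
    \<le> (SUP \<theta>\<in>{\<theta>. \<theta> \<noteq> 0}. norm (post_bias \<beta> A n x \<theta>)) * norm (\<theta> - \<theta>0)"
proof -
  define S where "S = (SUP \<theta>\<in>{\<theta>. \<theta> \<noteq> 0}. norm (post_bias \<beta> A n x \<theta>))"
  define G where "G \<theta> = ln (post_partition \<beta> A n x \<theta>) - log_cosh_sum n x \<theta>" for \<theta>
  have "norm (G \<theta> - G \<theta>0) \<le> S * norm (\<theta> - \<theta>0)"
  proof (rule differentiable_bound)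
    show "convex (ball \<theta>0 (norm \<theta>0))" by (rule convex_ball)
    fix t assume "t \<in> ball \<theta>0 (norm \<theta>0)"
    hence t: "t \<noteq> 0" by (auto simp: dist_norm)
    have "(G has_derivative (\<lambda>v. post_bias \<beta> A n x t \<bullet> v)) (at t)"
      unfolding G_def[abs_def] post_bias_def inner_diff_left
      by (intro has_derivative_diff ln_post_partition_has_derivative log_cosh_sum_has_derivative)
    thus "(G has_derivative (\<lambda>v. post_bias \<beta> A n x t \<bullet> v)) (at t within ball \<theta>0 (norm \<theta>0))"
      by (rule has_derivative_at_withinI)
    show "onorm (\<lambda>v. post_bias \<beta> A n x t \<bullet> v) \<le> S"
    proof (rule onorm_le)
      fix v
      have "norm (post_bias \<beta> A n x t \<bullet> v) \<le> norm (post_bias \<beta> A n x t) * norm v"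
        unfolding real_norm_def by (rule Cauchy_Schwarz_ineq2)
      also have "\<dots> \<le> S * norm v"
        unfolding S_def by (intro mult_right_mono norm_post_bias_le_SUP t) simp
      finally show "norm (post_bias \<beta> A n x t \<bullet> v) \<le> S * norm v" .
    qed
  qed (use \<theta> in \<open>auto simp: dist_norm norm_minus_commute\<close>)
  thus ?thesis unfolding ln_lik_ratio S_def[symmetric] by (simp add: G_def algebra_simps)
qed

section \<open>Second-order expansion of the log cosh sum\<close>

lemma ln_cosh_taylor:
  fixes a d :: real
  shows "\<bar>ln (cosh (a + d)) - ln (cosh a) - tanh a * d - (sech a)\<^sup>2 * d\<^sup>2 / 2\<bar> \<le> \<bar>d\<bar> ^ 3 / 3"
proof -
  \<comment> \<open>Successive derivatives of s \<mapsto> ln (cosh (a + s)) up to the third. With 1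
    - tanh^2 for sech^2 each one is a polynomial in tanh. The third is at most 2 in modulus, and 2 /
    3! gives the factor 1/3.\<close>
  define D :: "nat \<Rightarrow> real \<Rightarrow> real" where "D m s =
     (if m = 0 then ln (cosh (a + s)) else if m = 1 then tanh (a + s)
      else if m = 2 then 1 - (tanh (a + s))\<^sup>2
      else - 2 * tanh (a + s) * (1 - (tanh (a + s))\<^sup>2))" for m s
  have der: "\<forall>m t. m < 3 \<and> \<bar>t\<bar> \<le> \<bar>d\<bar> \<longrightarrow> (D m has_real_derivative D (Suc m) t) (at t)"
  proof (intro allI impI)
    fix m :: nat and t :: real assume "m < 3 \<and> \<bar>t\<bar> \<le> \<bar>d\<bar>"
    then consider "m = 0" | "m = 1" | "m = 2" by linarith
    then show "(D m has_real_derivative D (Suc m) t) (at t)"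
    proof cases
      case 1
      show ?thesis unfolding D_def[abs_def] 1
        by (auto intro!: derivative_eq_intros simp: tanh_def divide_inverse)
    next
      case 2
      show ?thesis unfolding D_def[abs_def] 2
        by (auto intro!: derivative_eq_intros)
    next
      case 3
      show ?thesis unfolding D_def[abs_def] 3
        by (auto intro!: derivative_eq_intros)
    qed
  qed
  obtain t where t: "ln (cosh (a + d)) = (\<Sum>m<3. D m 0 / fact m * d ^ m) + D 3 t / fact 3 * d ^ 3"
    using Maclaurin_bi_le[OF _ der, of "\<lambda>s. ln (cosh (a + s))"] by (auto simp: D_def fun_eq_iff)
  have sech: "(sech s)\<^sup>2 = 1 - (tanh s)\<^sup>2" for s :: real
    using sech_sq_plus_tanh_sq[of s] by simp
  have eq: "ln (cosh (a + d)) - ln (cosh a) - tanh a * d - (sech a)\<^sup>2 * d\<^sup>2 / 2 = D 3 t / 6 * d ^ 3"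
  proof -
    have "{..<3::nat} = {0, 1, 2}" by auto
    thus ?thesis unfolding t sech by (simp add: D_def fact_numeral)
  qed
  have "\<bar>D 3 t\<bar> \<le> 2"
  proof -
    have "\<bar>tanh (a + t)\<bar> * (sech (a + t))\<^sup>2 \<le> 1 * 1"
      using sech_bounds[of "a + t"] by (intro mult_mono abs_tanh_le_1 power_le_one) auto
    thus ?thesis by (simp add: D_def sech[symmetric] abs_mult)
  qed
  hence "\<bar>D 3 t / 6 * d ^ 3\<bar> \<le> 2 / 6 * \<bar>d\<bar> ^ 3"
    unfolding abs_mult power_abs by (intro mult_right_mono) auto
  thus ?thesis unfolding eq by simp
qed

text \<open>The number W is left free here; its later value E[(h \<bullet> X)^2 sech^2] turns |h|^2
  - W into the form of \<open>info0\<close>. The two errors are the fluctuation of the empirical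
  curvature around W and the cubic Taylor remainders, which carry the factor n^(-3/2).\<close>

lemma log_cosh_sum_expansion:
  fixes \<theta>0 h :: "real^'d"
  assumes n: "n > 0"
  defines "\<theta> \<equiv> \<theta>0 + (1 / sqrt (real n)) *\<^sub>R h"
  shows "\<bar>(log_cosh_sum n x \<theta> - log_cosh_sum n x \<theta>0 - real n * ((norm \<theta>)\<^sup>2 - (norm \<theta>0)\<^sup>2) / 2)
      - (h \<bullet> score_stat \<theta>0 n x - (1/2) * ((norm h)\<^sup>2 - W))\<bar>
    \<le> \<bar>(\<Sum>i<n. (h \<bullet> x i)\<^sup>2 * (sech (\<theta>0 \<bullet> x i))\<^sup>2 - W)\<bar> / (2 * real n)
      + (\<Sum>i<n. \<bar>h \<bullet> x i\<bar> ^ 3) / (3 * (real n * sqrt (real n)))"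
proof -
  define r where "r = sqrt (real n)"
  have r: "r > 0" "real n = r\<^sup>2" using n by (simp_all add: r_def)
  define T where "T i = tanh (\<theta>0 \<bullet> x i) * (h \<bullet> x i)" for i
  define V where "V i = (h \<bullet> x i)\<^sup>2 * (sech (\<theta>0 \<bullet> x i))\<^sup>2" for i
  define R where "R i = ln (cosh (\<theta> \<bullet> x i)) - ln (cosh (\<theta>0 \<bullet> x i)) - T i / r - V i / (2 * r\<^sup>2)" for i
  have R: "\<bar>R i\<bar> \<le> \<bar>h \<bullet> x i\<bar> ^ 3 / (3 * r ^ 3)" for i
  proof -
    have d: "\<theta> \<bullet> x i = \<theta>0 \<bullet> x i + (h \<bullet> x i) / r"
      unfolding \<theta>_def r_def by (simp add: inner_add_left)
    have "R i = ln (cosh (\<theta>0 \<bullet> x i + (h \<bullet> x i) / r)) - ln (cosh (\<theta>0 \<bullet> x i))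
        - tanh (\<theta>0 \<bullet> x i) * ((h \<bullet> x i) / r) - (sech (\<theta>0 \<bullet> x i))\<^sup>2 * ((h \<bullet> x i) / r)\<^sup>2 / 2"
      unfolding R_def d T_def V_def using r by (simp add: power_divide mult_ac)
    also have "\<bar>\<dots>\<bar> \<le> \<bar>(h \<bullet> x i) / r\<bar> ^ 3 / 3" by (rule ln_cosh_taylor)
    also have "\<dots> = \<bar>h \<bullet> x i\<bar> ^ 3 / (3 * r ^ 3)" using r by (simp add: power_divide)
    finally show ?thesis .
  qed
  have L: "log_cosh_sum n x \<theta> - log_cosh_sum n x \<theta>0 = (\<Sum>i<n. T i) / r + (\<Sum>i<n. V i) / (2 * r\<^sup>2) + (\<Sum>i<n. R i)"
    unfolding log_cosh_sum_def sum_divide_distrib sum.distrib[symmetric] sum_subtractf[symmetric]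
    by (intro sum.cong refl) (simp add: R_def)
  \<comment> \<open>Once subtracted, this supplies both the centring of the score and the term
    -|h|^2 / 2.\<close>
  have N: "real n * ((norm \<theta>)\<^sup>2 - (norm \<theta>0)\<^sup>2) / 2 = r * (h \<bullet> \<theta>0) + (norm h)\<^sup>2 / 2"
  proof -
    have "(norm \<theta>)\<^sup>2 = (norm \<theta>0)\<^sup>2 + 2 * (h \<bullet> \<theta>0) / r + (norm h)\<^sup>2 / r\<^sup>2"
      unfolding \<theta>_def r_def[symmetric] power2_norm_eq_inner
      by (simp add: inner_add_left inner_add_right inner_commute power2_eq_square)
    thus ?thesis unfolding r(2) using r(1) by (simp add: field_simps power2_eq_square)
  qed
  have S: "h \<bullet> score_stat \<theta>0 n x = (\<Sum>i<n. T i) / r - r * (h \<bullet> \<theta>0)"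
    unfolding score_stat_def r_def[symmetric] T_def r(2) using r(1)
    by (simp add: inner_diff_right inner_sum_right power2_eq_square field_simps)
  have "(log_cosh_sum n x \<theta> - log_cosh_sum n x \<theta>0 - real n * ((norm \<theta>)\<^sup>2 - (norm \<theta>0)\<^sup>2) / 2)
      - (h \<bullet> score_stat \<theta>0 n x - (1/2) * ((norm h)\<^sup>2 - W))
     = (\<Sum>i<n. V i) / (2 * r\<^sup>2) - W / 2 + (\<Sum>i<n. R i)"
    unfolding L N S by (simp add: algebra_simps)
  also have "(\<Sum>i<n. V i) / (2 * r\<^sup>2) - W / 2 = (\<Sum>i<n. V i - W) / (2 * r\<^sup>2)"
  proof -
    have "(\<Sum>i<n. V i - W) = (\<Sum>i<n. V i) - r\<^sup>2 * W" by (simp add: sum_subtractf r(2)[symmetric])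
    thus ?thesis using r(1) by (simp add: field_simps)
  qed
  also have "\<bar>(\<Sum>i<n. V i - W) / (2 * r\<^sup>2) + (\<Sum>i<n. R i)\<bar>
      \<le> \<bar>\<Sum>i<n. V i - W\<bar> / (2 * r\<^sup>2) + \<bar>\<Sum>i<n. R i\<bar>"
    using abs_triangle_ineq[of "(\<Sum>i<n. V i - W) / (2 * r\<^sup>2)"] by simp
  also have "\<bar>\<Sum>i<n. R i\<bar> \<le> (\<Sum>i<n. \<bar>h \<bullet> x i\<bar> ^ 3 / (3 * r ^ 3))"
    by (rule order_trans[OF sum_abs sum_mono]) (rule R)
  also have "\<dots> = (\<Sum>i<n. \<bar>h \<bullet> x i\<bar> ^ 3) / (3 * (r\<^sup>2 * r))"
    by (simp add: sum_divide_distrib power2_eq_square power3_eq_cube)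
  finally show ?thesis unfolding V_def r(2)[symmetric] by (simp add: r_def)
qed

section \<open>Local asymptotic normality\<close>

text \<open>Chebyshev: the sum has variance n v against the squared threshold \<delta>^2
  n^2.\<close>

lemma iid_weak_law:
  fixes U :: "'a \<Rightarrow> real"
  assumes N: "prob_space N" and U: "integrable N U" "integrable N (\<lambda>x. (U x)\<^sup>2)" "(\<integral>x. U x \<partial>N) = 0"
    and \<delta>: "\<delta> > 0"
  shows "(\<lambda>n. measure (PiM {..<n} (\<lambda>_. N))
      {x \<in> space (PiM {..<n} (\<lambda>_. N)). \<delta> * real n < \<bar>\<Sum>i<n. U (x i)\<bar>}) \<longlonglongrightarrow> 0"
proof (rule tendsto_sandwich[OF _ _ tendsto_const])
  let ?Q = "\<lambda>n. PiM {..<n} (\<lambda>_. N)"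
  let ?v = "\<integral>x. (U x)\<^sup>2 \<partial>N"
  note [measurable] = borel_measurable_integrable[OF U(1)]
  show "\<forall>\<^sub>F n in sequentially. 0 \<le> measure (?Q n) {x \<in> space (?Q n). \<delta> * real n < \<bar>\<Sum>i<n. U (x i)\<bar>}"
    by simp
  show "(\<lambda>n. (?v / \<delta>\<^sup>2) / real n) \<longlonglongrightarrow> 0" by (rule lim_const_over_n)
  show "\<forall>\<^sub>F n in sequentially. measure (?Q n) {x \<in> space (?Q n). \<delta> * real n < \<bar>\<Sum>i<n. U (x i)\<bar>} \<le> (?v / \<delta>\<^sup>2) / real n"
    using eventually_gt_at_top[of 0]
  proof eventually_elim
    case (elim n)
    interpret Q: prob_space "?Q n" by (rule prob_space_PiM) (rule N)
    have "measure (?Q n) {x \<in> space (?Q n). \<delta> * real n < \<bar>\<Sum>i<n. U (x i)\<bar>}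
        \<le> measure (?Q n) {x \<in> space (?Q n). (\<delta> * real n)\<^sup>2 \<le> (\<Sum>i<n. U (x i))\<^sup>2}"
      using \<delta> by (intro Q.finite_measure_mono) (auto intro!: power2_le_iff_abs_le[THEN iffD2] simp: abs_le_square_iff[symmetric])
    also have "\<dots> \<le> (\<integral>x. (\<Sum>i<n. U (x i))\<^sup>2 \<partial>?Q n) / (\<delta> * real n)\<^sup>2"
      by (rule integral_Markov_inequality_measure[where A="{}"])
         (use iid_sum_second_moment(1)[OF N U, of n] \<delta> elim in auto)
    also have "\<dots> = real n * ?v / (\<delta> * real n)\<^sup>2" by (simp only: iid_sum_second_moment(2)[OF N U])
    also have "\<dots> = (?v / \<delta>\<^sup>2) / real n" using elim by (simp add: power2_eq_square)
    finally show ?case .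
  qed
qed

text \<open>Markov: the sum has mean n m, and the threshold of order n^(3/2) outgrows it by sqrt
  n.\<close>

lemma iid_sum_negligible:
  fixes V :: "'a \<Rightarrow> real"
  assumes N: "prob_space N" and V: "integrable N V" "\<And>x. 0 \<le> V x" and \<delta>: "\<delta> > 0"
  shows "(\<lambda>n. measure (PiM {..<n} (\<lambda>_. N))
      {x \<in> space (PiM {..<n} (\<lambda>_. N)). \<delta> * (real n * sqrt (real n)) < (\<Sum>i<n. V (x i))}) \<longlonglongrightarrow> 0"
proof (rule tendsto_sandwich[OF _ _ tendsto_const])
  let ?Q = "\<lambda>n. PiM {..<n} (\<lambda>_. N)"
  let ?m = "\<integral>x. V x \<partial>N"
  note [measurable] = borel_measurable_integrable[OF V(1)]
  show "\<forall>\<^sub>F n in sequentially. 0 \<le> measure (?Q n) {x \<in> space (?Q n). \<delta> * (real n * sqrt (real n)) < (\<Sum>i<n. V (x i))}"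
    by simp
  show "(\<lambda>n. (?m / \<delta>) / sqrt (real n)) \<longlonglongrightarrow> 0"
    by (intro tendsto_divide_0[OF tendsto_const] filterlim_at_top_imp_at_infinity
          filterlim_compose[OF sqrt_at_top filterlim_real_sequentially])
  show "\<forall>\<^sub>F n in sequentially. measure (?Q n) {x \<in> space (?Q n). \<delta> * (real n * sqrt (real n)) < (\<Sum>i<n. V (x i))}
      \<le> (?m / \<delta>) / sqrt (real n)"
    using eventually_gt_at_top[of 0]
  proof eventually_elim
    case (elim n)
    interpret Q: prob_space "?Q n" by (rule prob_space_PiM) (rule N)
    have int: "integrable (?Q n) (\<lambda>x. \<Sum>i<n. V (x i))"
      by (intro Bochner_Integration.integrable_sum iid_coordinate(1)[OF N V(1)]) simp
    have "(\<integral>x. (\<Sum>i<n. V (x i)) \<partial>?Q n) = (\<Sum>i<n. \<integral>x. V (x i) \<partial>?Q n)"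
      by (rule Bochner_Integration.integral_sum) (auto intro: iid_coordinate(1)[OF N V(1)])
    also have "\<dots> = real n * ?m"
      by (simp add: iid_coordinate(2)[OF N V(1)])
    finally have E: "(\<integral>x. (\<Sum>i<n. V (x i)) \<partial>?Q n) = real n * ?m" .
    have "measure (?Q n) {x \<in> space (?Q n). \<delta> * (real n * sqrt (real n)) < (\<Sum>i<n. V (x i))}
        \<le> measure (?Q n) {x \<in> space (?Q n). \<delta> * (real n * sqrt (real n)) \<le> (\<Sum>i<n. V (x i))}"
      by (intro Q.finite_measure_mono) auto
    also have "\<dots> \<le> (\<integral>x. (\<Sum>i<n. V (x i)) \<partial>?Q n) / (\<delta> * (real n * sqrt (real n)))"
      by (rule integral_Markov_inequality_measure[where A="{}"])
         (use int V(2) \<delta> elim in \<open>auto intro!: AE_I2 sum_nonneg\<close>)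
    also have "\<dots> = (?m / \<delta>) / sqrt (real n)" unfolding E using elim by simp
    finally show ?case .
  qed
qed

section \<open>Asymptotic normality of the score\<close>

lemma borel_measurable_score_stat [measurable]: "score_stat \<theta> n \<in> borel_measurable (sample_space n)"
  unfolding score_stat_def
  by (intro borel_measurable_scaleR borel_measurable_diff borel_measurable_sum borel_measurable_const
      measurable_compose[OF _ borel_measurable_tanh] borel_measurable_inner) auto

text \<open>The map y \<mapsto> tanh (\<theta> \<bullet> y) y is even.\<close>

lemma score_stat_flip:
  assumes "z \<in> spins n"
  shows "score_stat \<theta> n (flip n z x) = score_stat \<theta> n x"
proof -
  have "tanh (\<theta> \<bullet> flip n z x i) *\<^sub>R flip n z x i = tanh (\<theta> \<bullet> x i) *\<^sub>R x i" if "i < n" for i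
    using spins_cases[OF assms that] that by (auto simp: flip_def)
  thus ?thesis unfolding score_stat_def by simp
qed

lemma inner_score_stat:
  "t \<bullet> score_stat \<theta> n x = (\<Sum>i<n. centred_score \<theta> t (x i) / sqrt (real n))"
\<comment> \<open>At n = 0 both sides vanish: the sum is empty, and the factor sqrt 0 removes the
  centring \<theta>.\<close>
proof (cases "n = 0")
  case False
  define r where "r = sqrt (real n)"
  have r: "r > 0" "real n = r * r" using False by (simp_all add: r_def)
  have "(\<Sum>i<n. centred_score \<theta> t (x i) / r) = ((\<Sum>i<n. tanh (\<theta> \<bullet> x i) * (t \<bullet> x i)) - real n * (t \<bullet> \<theta>)) / r"
    by (simp add: centred_score_def sum_subtractf mult_ac flip: sum_divide_distrib)
  also have "\<dots> = t \<bullet> score_stat \<theta> n x"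
    unfolding score_stat_def r_def[symmetric] r(2) using r(1)
    by (simp add: inner_diff_right inner_sum_right field_simps)
  finally show ?thesis unfolding r_def ..
qed (simp add: score_stat_def)

text \<open>For n > 0 the bound is an equality; the inequality absorbs n = 0, where the score is
  zero.\<close>

lemma integral_inner_score_stat_sq:
  "integrable (iid_sample \<theta> n) (\<lambda>x. (t \<bullet> score_stat \<theta> n x)\<^sup>2)"
  "(\<integral>x. (t \<bullet> score_stat \<theta> n x)\<^sup>2 \<partial>iid_sample \<theta> n) \<le> t \<bullet> (info0 \<theta> *v t)"
proof -
  have U: "integrable (mvnormal_at \<theta>) (centred_score \<theta> t)"
      "integrable (mvnormal_at \<theta>) (\<lambda>x. (centred_score \<theta> t x)\<^sup>2)"
    using integrable_centred_score_power[of \<theta> t 1] integrable_centred_score_power[of \<theta> t 2] by simp_all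
  have eq: "(t \<bullet> score_stat \<theta> n x)\<^sup>2 = (\<Sum>i<n. centred_score \<theta> t (x i))\<^sup>2 / real n" for x
    unfolding inner_score_stat sum_divide_distrib[symmetric] by (simp add: power_divide)
  show "integrable (iid_sample \<theta> n) (\<lambda>x. (t \<bullet> score_stat \<theta> n x)\<^sup>2)"
    unfolding eq
    using iid_sum_second_moment(1)[OF prob_space_mvnormal_at U integral_centred_score, of n] by simp
  show "(\<integral>x. (t \<bullet> score_stat \<theta> n x)\<^sup>2 \<partial>iid_sample \<theta> n) \<le> t \<bullet> (info0 \<theta> *v t)"
    unfolding eq using info0_psd[of t \<theta>]
    by (simp add: iid_sum_second_moment(2)[OF prob_space_mvnormal_at U integral_centred_score] integral_centred_score_sq)
qed

theorem score_stat_asymptotically_normal: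
  "weak_conv_vec (\<lambda>n. distr (model \<beta> A \<theta> n) borel (score_stat \<theta> n)) (mvnormal (info0 \<theta>))"
proof -
  \<comment> \<open>The first entry is the trace of the information matrix and bounds the second
    moments of the scores; the second is that of the limit. The continuity theorem asks for one
    constant for both.\<close>
  define C where "C = max (\<Sum>b\<in>Basis. b \<bullet> (info0 \<theta> *v b)) (\<integral>x. (norm x)\<^sup>2 \<partial>mvnormal (info0 \<theta>))"
  note L = mvnormal_props[OF transpose_info0 info0_psd, of \<theta>]
  note sets_iid_sample[measurable_cong]
  have eq: "distr (model \<beta> A \<theta> n) borel (score_stat \<theta> n) = distr (iid_sample \<theta> n) borel (score_stat \<theta> n)" for n
    by (rule distr_model_flip_invariant) (auto simp: score_stat_flip)
  show ?thesis unfolding eq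
  proof (rule weak_conv_vec_of_char_convergence)
    show "prob_space (distr (iid_sample \<theta> n) borel (score_stat \<theta> n))" for n
      by (rule prob_space.prob_space_distr[OF prob_space_iid_sample]) simp
    show "(\<lambda>n. \<integral>x. iexp (t \<bullet> x) \<partial>distr (iid_sample \<theta> n) borel (score_stat \<theta> n))
        \<longlonglongrightarrow> (\<integral>x. iexp (t \<bullet> x) \<partial>mvnormal (info0 \<theta>))" for t
    proof -
      have "(\<integral>x. iexp (t \<bullet> x) \<partial>distr (iid_sample \<theta> n) borel (score_stat \<theta> n))
          = (\<integral>x. iexp (centred_score \<theta> t x / sqrt (real n)) \<partial>mvnormal_at \<theta>) ^ n" for n
      proof -
        have "(\<integral>x. iexp (t \<bullet> x) \<partial>distr (iid_sample \<theta> n) borel (score_stat \<theta> n))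
            = (\<integral>x. iexp (\<Sum>i<n. centred_score \<theta> t (x i) / sqrt (real n)) \<partial>iid_sample \<theta> n)"
          unfolding inner_score_stat[symmetric] by (subst integral_distr) auto
        also have "\<dots> = (\<integral>x. iexp (centred_score \<theta> t x / sqrt (real n)) \<partial>mvnormal_at \<theta>) ^ n"
          by (rule iid_char_sum[OF prob_space_mvnormal_at]) measurable
        finally show ?thesis .
      qed
      moreover have "(\<lambda>n. (\<integral>x. iexp (centred_score \<theta> t x / sqrt (real n)) \<partial>mvnormal_at \<theta>) ^ n)
          \<longlonglongrightarrow> exp (- (t \<bullet> (info0 \<theta> *v t)) / 2)"
        by (rule char_power_tendsto_gaussian[OF prob_space_mvnormal_at])
           (auto intro: integrable_centred_score_power simp: integral_centred_score integral_centred_score_sq)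
      ultimately show ?thesis by (simp only: L(3))
    qed
    show "integrable (distr (iid_sample \<theta> n) borel (score_stat \<theta> n)) (\<lambda>x. (norm x)\<^sup>2)" for n
      by (subst integrable_distr_eq)
         (auto simp only: norm_sq_eq_sum_Basis intro!: Bochner_Integration.integrable_sum integral_inner_score_stat_sq, auto)
    show "(\<integral>x. (norm x)\<^sup>2 \<partial>distr (iid_sample \<theta> n) borel (score_stat \<theta> n)) \<le> C" for n
    proof -
      have "(\<integral>x. (norm x)\<^sup>2 \<partial>distr (iid_sample \<theta> n) borel (score_stat \<theta> n))
          = (\<integral>x. (\<Sum>b\<in>Basis. (b \<bullet> score_stat \<theta> n x)\<^sup>2) \<partial>iid_sample \<theta> n)"
        by (subst integral_distr) (auto simp: norm_sq_eq_sum_Basis)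
      also have "\<dots> = (\<Sum>b\<in>Basis. \<integral>x. (b \<bullet> score_stat \<theta> n x)\<^sup>2 \<partial>iid_sample \<theta> n)"
        by (rule Bochner_Integration.integral_sum) (rule integral_inner_score_stat_sq)
      also have "\<dots> \<le> (\<Sum>b\<in>Basis. b \<bullet> (info0 \<theta> *v b))"
        by (rule sum_mono) (rule integral_inner_score_stat_sq)
      finally show ?thesis by (simp add: C_def)
    qed
  qed (use L in \<open>auto simp: C_def\<close>)
qed

lemma even_functions_flip:
  assumes "z \<in> spins n" "i < n"
  shows "\<bar>u \<bullet> flip n z x i\<bar> = \<bar>u \<bullet> x i\<bar>" "(u \<bullet> flip n z x i)\<^sup>2 = (u \<bullet> x i)\<^sup>2" "sech (u \<bullet> flip n z x i) = sech (u \<bullet> x i)"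
  using spins_cases[OF assms] assms(2) by (auto simp: flip_def sech_def)

text \<open>There are three sources of error, each granted \<epsilon> / 3: the posterior bias
  accumulated over the step, the fluctuation of the empirical curvature, and the cubic
  remainder.\<close>

theorem log_likelihood_expansion:
  fixes \<theta>0 :: "real^'d"
  assumes \<theta>0: "\<theta>0 \<noteq> 0"
    and unif: "o_prob (model \<beta> A \<theta>0)
        (\<lambda>n x. SUP \<theta>\<in>{\<theta>. \<theta> \<noteq> 0}. norm (post_bias \<beta> A n x \<theta>)) (\<lambda>n. sqrt (real n))"
  shows "o_prob (model \<beta> A \<theta>0)
      (\<lambda>n x. ln (lik \<beta> A n (\<theta>0 + (1 / sqrt (real n)) *\<^sub>R h) x / lik \<beta> A n \<theta>0 x)
             - (h \<bullet> score_stat \<theta>0 n x - (1/2) * (h \<bullet> (info0 \<theta>0 *v h)))) (\<lambda>n. 1)"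
  unfolding o_prob_def
proof (intro conjI allI impI)
  let ?Y = "\<lambda>n x. ln (lik \<beta> A n (\<theta>0 + (1 / sqrt (real n)) *\<^sub>R h) x / lik \<beta> A n \<theta>0 x)
             - (h \<bullet> score_stat \<theta>0 n x - (1/2) * (h \<bullet> (info0 \<theta>0 *v h)))"
  show Y [measurable]: "?Y n \<in> borel_measurable (model \<beta> A \<theta>0 n)" for n by measurable
  fix \<epsilon> :: real assume \<epsilon>: "\<epsilon> > 0"
  let ?P = "\<lambda>n. model \<beta> A \<theta>0 n" and ?Q = "\<lambda>n. iid_sample \<theta>0 n"
  define W where "W = (\<integral>x. (h \<bullet> x)\<^sup>2 * (sech (\<theta>0 \<bullet> x))\<^sup>2 \<partial>mvnormal_at \<theta>0)"
  define U where "U x = (h \<bullet> x)\<^sup>2 * (sech (\<theta>0 \<bullet> x))\<^sup>2 - W" for x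
  have [measurable]: "U \<in> borel_measurable borel" unfolding U_def by measurable
  define S where "S n x = (SUP \<theta>\<in>{\<theta>. \<theta> \<noteq> 0}. norm (post_bias \<beta> A n x \<theta>))" for n and x :: "nat \<Rightarrow> real^'d"
  have S_meas: "S n \<in> borel_measurable (?P n)" for n
    using unif unfolding o_prob_def S_def[abs_def] by blast
  \<comment> \<open>A bias of at most \<epsilon>1 sqrt n over a step of length |h| / sqrt n costs at
    most \<epsilon> / 3; the added 1 covers h = 0.\<close>
  define \<epsilon>1 where "\<epsilon>1 = \<epsilon> / (3 * (norm h + 1))"
  have \<epsilon>1: "\<epsilon>1 > 0" unfolding \<epsilon>1_def using \<epsilon> by (simp add: add_nonneg_pos)
  \<comment> \<open>This event is stated under the model itself, as in the hypothesis, whereas the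
    two below see only even functions of the observations and are moved to the i.i.d. law.\<close>
  define E1 where "E1 n = {x \<in> space (?P n). \<epsilon>1 * sqrt (real n) < \<bar>S n x\<bar>}" for n
  \<comment> \<open>The thresholds of \<open>E2\<close> and \<open>E3\<close> anticipate the
    divisors 2n and 3 n sqrt n of \<open>log_cosh_sum_expansion\<close>, so that \<epsilon> / 3
    remains in each case.\<close>
  define E2 where "E2 n = {x \<in> space (sample_space n). (2 * \<epsilon> / 3) * real n < \<bar>\<Sum>i<n. U (x i)\<bar>}" for n
  define E3 where "E3 n = {x \<in> space (sample_space n). \<epsilon> * (real n * sqrt (real n)) < (\<Sum>i<n. \<bar>h \<bullet> x i\<bar> ^ 3)}" for n
  have E1: "E1 n \<in> sets (?P n)" for n
    unfolding E1_def using S_meas[of n] by measurable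
  have E2 [measurable]: "E2 n \<in> sets (sample_space n)" for n unfolding E2_def by measurable
  have E3 [measurable]: "E3 n \<in> sets (sample_space n)" for n unfolding E3_def by measurable
  have lim1: "(\<lambda>n. measure (?P n) (E1 n)) \<longlonglongrightarrow> 0"
    using unif \<epsilon>1 unfolding o_prob_def E1_def S_def by blast
  have lim2: "(\<lambda>n. measure (?P n) (E2 n)) \<longlonglongrightarrow> 0"
  proof -
    have "measure (?P n) (E2 n) = measure (?Q n) (E2 n)" for n
      by (rule measure_model_flip_invariant)
         (auto simp: E2_def U_def even_functions_flip dest: measurable_space[OF measurable_flip])
    moreover have "(\<lambda>n. measure (?Q n) (E2 n)) \<longlonglongrightarrow> 0"
      unfolding E2_def space_iid_sample[of _ \<theta>0, symmetric]
    proof (rule iid_weak_law[OF prob_space_mvnormal_at])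
      have int: "integrable (mvnormal_at \<theta>0) (\<lambda>x. (h \<bullet> x)\<^sup>2 * (sech (\<theta>0 \<bullet> x))\<^sup>2)"
        by (rule integrable_mvnormal_at_inner_sq_sech)
      show "integrable (mvnormal_at \<theta>0) U" unfolding U_def using int by simp
      show "(\<integral>x. U x \<partial>mvnormal_at \<theta>0) = 0"
        unfolding U_def using int by (simp add: W_def mvnormal_at.prob_space[simplified])
      show "integrable (mvnormal_at \<theta>0) (\<lambda>x. (U x)\<^sup>2)"
      proof (rule Bochner_Integration.integrable_bound)
        \<comment> \<open>Since sech \<le> 1, |U| is at most (h \<bullet> x)^2 + |W|, so fourth
          moments of the normal law dominate the square.\<close>
        show "integrable (mvnormal_at \<theta>0) (\<lambda>x. 2\<^sup>2 * (\<bar>h \<bullet> x\<bar> ^ 4 + \<bar>W\<bar>\<^sup>2))"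
          by (intro integrable_mult_right Bochner_Integration.integrable_add integrable_mvnormal_at_abs_inner_pow) simp
        show "AE x in mvnormal_at \<theta>0. norm ((U x)\<^sup>2) \<le> norm (2\<^sup>2 * (\<bar>h \<bullet> x\<bar> ^ 4 + \<bar>W\<bar>\<^sup>2))"
        proof (rule AE_I2)
          fix x
          have "(h \<bullet> x)\<^sup>2 * (sech (\<theta>0 \<bullet> x))\<^sup>2 \<le> (h \<bullet> x)\<^sup>2 * 1"
            using sech_bounds[of "\<theta>0 \<bullet> x"] by (intro mult_left_mono power_le_one) auto
          moreover have "0 \<le> (h \<bullet> x)\<^sup>2 * (sech (\<theta>0 \<bullet> x))\<^sup>2" by simp
          ultimately have "\<bar>U x\<bar> \<le> (h \<bullet> x)\<^sup>2 + \<bar>W\<bar>" unfolding U_def by linarith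
          hence "\<bar>U x\<bar>\<^sup>2 \<le> ((h \<bullet> x)\<^sup>2 + \<bar>W\<bar>)\<^sup>2" by (intro power_mono) auto
          also have "\<dots> \<le> 2\<^sup>2 * (((h \<bullet> x)\<^sup>2)\<^sup>2 + \<bar>W\<bar>\<^sup>2)" by (rule add_power_le) auto
          finally show "norm ((U x)\<^sup>2) \<le> norm (2\<^sup>2 * (\<bar>h \<bullet> x\<bar> ^ 4 + \<bar>W\<bar>\<^sup>2))" by simp
        qed
      qed simp
    qed (use \<epsilon> in simp)
    ultimately show ?thesis by simp
  qed
  have lim3: "(\<lambda>n. measure (?P n) (E3 n)) \<longlonglongrightarrow> 0"
  proof -
    have "measure (?P n) (E3 n) = measure (?Q n) (E3 n)" for n
      by (rule measure_model_flip_invariant)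
         (auto simp: E3_def even_functions_flip dest: measurable_space[OF measurable_flip])
    moreover have "(\<lambda>n. measure (?Q n) (E3 n)) \<longlonglongrightarrow> 0"
      unfolding E3_def space_iid_sample[of _ \<theta>0, symmetric]
      by (rule iid_sum_negligible[OF prob_space_mvnormal_at integrable_mvnormal_at_abs_inner_pow])
         (use \<epsilon> in auto)
    ultimately show ?thesis by simp
  qed
  \<comment> \<open>The condition on n places the local parameter closer to \<theta>0 than the
    origin is, which is the range of \<open>ln_lik_ratio_approx\<close>; it holds for all large
    n.\<close>
  have bound: "measure (?P n) {x \<in> space (?P n). \<bar>?Y n x\<bar> > \<epsilon> * 1}
      \<le> measure (?P n) (E1 n) + measure (?P n) (E2 n) + measure (?P n) (E3 n)"
    if n: "n > 0" and nh: "norm h / sqrt (real n) < norm \<theta>0" for n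
  proof -
    interpret P: prob_space "?P n" by (rule prob_space_model)
    have sub: "{x \<in> space (?P n). \<bar>?Y n x\<bar> > \<epsilon> * 1} \<subseteq> E1 n \<union> E2 n \<union> E3 n"
    proof (rule subsetI, rule ccontr)
      fix x assume x: "x \<in> {x \<in> space (?P n). \<bar>?Y n x\<bar> > \<epsilon> * 1}" and not: "x \<notin> E1 n \<union> E2 n \<union> E3 n"
      define r where "r = sqrt (real n)"
      have r: "r > 0" using n by (simp add: r_def)
      have s1: "\<bar>S n x\<bar> \<le> \<epsilon>1 * r" and s2: "\<bar>\<Sum>i<n. U (x i)\<bar> \<le> (2 * \<epsilon> / 3) * real n"
        and s3: "(\<Sum>i<n. \<bar>h \<bullet> x i\<bar> ^ 3) \<le> \<epsilon> * (real n * r)"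
        using x not by (auto simp: E1_def E2_def E3_def r_def not_less)
      let ?\<theta> = "\<theta>0 + (1 / sqrt (real n)) *\<^sub>R h"
      have d: "norm (?\<theta> - \<theta>0) = norm h / r" using r by (simp add: r_def)
      have "\<bar>ln (lik \<beta> A n ?\<theta> x / lik \<beta> A n \<theta>0 x)
          - (log_cosh_sum n x ?\<theta> - log_cosh_sum n x \<theta>0 - real n * ((norm ?\<theta>)\<^sup>2 - (norm \<theta>0)\<^sup>2) / 2)\<bar>
          \<le> S n x * norm (?\<theta> - \<theta>0)"
        unfolding S_def by (rule ln_lik_ratio_approx) (use nh in \<open>simp only: d r_def\<close>)
      moreover have "S n x * norm (?\<theta> - \<theta>0) \<le> \<epsilon> / 3"
      proof -
        have "S n x * norm (?\<theta> - \<theta>0) \<le> (\<epsilon>1 * r) * (norm h / r)"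
          unfolding d using s1 r by (intro mult_right_mono) auto
        also have "\<dots> = (\<epsilon> / 3) * (norm h / (norm h + 1))"
          using r by (simp add: \<epsilon>1_def)
        also have "\<dots> \<le> (\<epsilon> / 3) * 1"
          using \<epsilon> by (intro mult_left_mono) (auto simp: divide_le_eq add_nonneg_pos)
        finally show ?thesis by simp
      qed
      moreover have "\<bar>(log_cosh_sum n x ?\<theta> - log_cosh_sum n x \<theta>0 - real n * ((norm ?\<theta>)\<^sup>2 - (norm \<theta>0)\<^sup>2) / 2)
          - (h \<bullet> score_stat \<theta>0 n x - (1/2) * (h \<bullet> (info0 \<theta>0 *v h)))\<bar>
          \<le> \<bar>\<Sum>i<n. U (x i)\<bar> / (2 * real n) + (\<Sum>i<n. \<bar>h \<bullet> x i\<bar> ^ 3) / (3 * (real n * r))"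
        using log_cosh_sum_expansion[OF n, of x \<theta>0 h W]
        unfolding info0_quadratic_form W_def[symmetric] U_def r_def .
      moreover have "\<bar>\<Sum>i<n. U (x i)\<bar> / (2 * real n) \<le> \<epsilon> / 3"
        using s2 n by (simp add: divide_le_eq)
      moreover have "(\<Sum>i<n. \<bar>h \<bullet> x i\<bar> ^ 3) / (3 * (real n * r)) \<le> \<epsilon> / 3"
        using s3 n r by (simp add: divide_le_eq)
      ultimately have "\<bar>?Y n x\<bar> \<le> \<epsilon>" by linarith
      thus False using x by simp
    qed
    have "measure (?P n) {x \<in> space (?P n). \<bar>?Y n x\<bar> > \<epsilon> * 1} \<le> measure (?P n) (E1 n \<union> E2 n \<union> E3 n)"
      by (rule P.finite_measure_mono[OF sub]) (use E1 E2 E3 in auto)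
    also have "\<dots> \<le> measure (?P n) (E1 n \<union> E2 n) + measure (?P n) (E3 n)"
      by (rule measure_Un_le) (use E1 E2 E3 in auto)
    also have "measure (?P n) (E1 n \<union> E2 n) \<le> measure (?P n) (E1 n) + measure (?P n) (E2 n)"
      by (rule measure_Un_le) (use E1 E2 in auto)
    finally show ?thesis by simp
  qed
  have "(\<lambda>n. norm h / sqrt (real n)) \<longlonglongrightarrow> 0"
    by (intro tendsto_divide_0[OF tendsto_const] filterlim_at_top_imp_at_infinity
          filterlim_compose[OF sqrt_at_top filterlim_real_sequentially])
  hence "\<forall>\<^sub>F n in sequentially. norm h / sqrt (real n) < norm \<theta>0"
    by (rule order_tendstoD(2)) (use \<theta>0 in simp)
  hence ev: "\<forall>\<^sub>F n in sequentially. measure (?P n) {x \<in> space (?P n). \<bar>?Y n x\<bar> > \<epsilon> * 1}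
      \<le> measure (?P n) (E1 n) + measure (?P n) (E2 n) + measure (?P n) (E3 n)"
    using eventually_gt_at_top[of 0] by eventually_elim (rule bound)
  show "(\<lambda>n. measure (?P n) {x \<in> space (?P n). \<bar>?Y n x\<bar> > \<epsilon> * 1}) \<longlonglongrightarrow> 0"
    by (rule tendsto_sandwich[OF _ ev tendsto_const])
       (use tendsto_add[OF tendsto_add[OF lim1 lim2] lim3] in auto)
qed

text \<open>Gives the ball of radius \<open>norm \<theta>0\<close> around \<theta>0, on which the
  gradients are compared, a positive radius.\<close>

lemma lex_pos_nonzero: "lex_pos \<theta> \<Longrightarrow> \<theta> \<noteq> 0"
  by (auto simp: lex_pos_def)

theorem mainTheorem4:
  fixes \<beta> :: real
    and A :: "nat \<Rightarrow> nat \<Rightarrow> nat \<Rightarrow> real"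
    and \<theta>0 :: "real^'d::{finite,linorder}"
  assumes beta: "0 \<le> \<beta>"
    and A_sym: "\<And>n i j. i < n \<Longrightarrow> j < n \<Longrightarrow> A n i j = A n j i"
    and A_nonneg: "\<And>n i j. i < n \<Longrightarrow> j < n \<Longrightarrow> 0 \<le> A n i j"
    and A_diag: "\<And>n i. i < n \<Longrightarrow> A n i i = 0"
    and theta0: "lex_pos \<theta>0"
    and unif: "o_prob (model \<beta> A \<theta>0)
        (\<lambda>n x. SUP \<theta>\<in>{\<theta>. \<theta> \<noteq> 0}.
            norm (post_mean \<beta> A n \<theta> x - (\<Sum>i<n. tanh (\<theta> \<bullet> x i) *\<^sub>R x i)))
        (\<lambda>n. sqrt (real n))"
  shows "(\<forall>h.
            o_prob (model \<beta> A \<theta>0)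
              (\<lambda>n x. ln (lik \<beta> A n (\<theta>0 + (1 / sqrt (real n)) *\<^sub>R h) x / lik \<beta> A n \<theta>0 x)
                     - (h \<bullet> score_stat \<theta>0 n x - (1/2) * (h \<bullet> (info0 \<theta>0 *v h))))
              (\<lambda>n. 1))
         \<and> weak_conv_vec (\<lambda>n. distr (model \<beta> A \<theta>0 n) borel (score_stat \<theta>0 n))
              (mvnormal (info0 \<theta>0))"
  using log_likelihood_expansion[OF lex_pos_nonzero[OF theta0] unif[folded post_bias_def]]
    score_stat_asymptotically_normal by blast

end
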